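(* Let $(X,T)$ be an invertible topological dynamical system with positive topological entropy. Then $(X,T)$ has proper asymptotic pairs. More precisely, for every ergodic measure $\mu$ on $X$ with positive entropy $h_\mu(X,T)>0$, the set of points of $X$ belonging to a proper asymptotic pair has $\mu$-measure $1$.
   Context: An (invertible) topological dynamical system $(X,T)$ is a compact metric space $X$ with distance $d$ together with a homeomorphism $T:X\to X$. An ergodic measure is a $T$-invariant ergodic Borel probability measure on $X$. A pair $(x,y)\in X\times X$ is asymptotic if $\lim_{n\to+\infty}d(T^nx,T^ny)=0$; it is proper if moreover $x\neq y$. A point $x$ belongs to a proper asymptotic pair if there is $y\neq x$ such that $(x,y)$ is asymptotic. The set of such points may fail to be Borel, but it is measurable for the completion of every Borel probability measure; its measure is understood in this sense. *)

theory Defs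
  imports "HOL-Probability.Probability"
begin

definition invertible_tds :: "'a::metric_space set \<Rightarrow> ('a \<Rightarrow> 'a) \<Rightarrow> bool" where
  "invertible_tds X T \<longleftrightarrow> compact X \<and> (\<exists>S. homeomorphism X X T S)"


definition asymptotic_pairs :: "'a::metric_space set \<Rightarrow> ('a \<Rightarrow> 'a) \<Rightarrow> ('a \<times> 'a) set" where
  "asymptotic_pairs X T =
    {(x, y). x \<in> X \<and> y \<in> X \<and> (\<lambda>n. dist ((T ^^ n) x) ((T ^^ n) y)) \<longlonglongrightarrow> 0}"

definition proper_asymptotic_pairs :: "'a::metric_space set \<Rightarrow> ('a \<Rightarrow> 'a) \<Rightarrow> ('a \<times> 'a) set" where
  "proper_asymptotic_pairs X T = {(x, y) \<in> asymptotic_pairs X T. x \<noteq> y}"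


definition cover_join :: "'a set set \<Rightarrow> 'a set set \<Rightarrow> 'a set set" where
  "cover_join \<U> \<V> = {A \<inter> B | A B. A \<in> \<U> \<and> B \<in> \<V>}"

text \<open>
  The join of \<open>T\<^sup>-\<^sup>i \<U>\<close> over \<open>i < n\<close>, for a family \<open>\<U>\<close> of subsets of the carrier \<open>X\<close>;
  it is used both for open covers and for measurable partitions.
\<close>
primrec iterated_join :: "'a set \<Rightarrow> ('a \<Rightarrow> 'a) \<Rightarrow> 'a set set \<Rightarrow> nat \<Rightarrow> 'a set set" where
  "iterated_join X T \<U> 0 = {X}"
| "iterated_join X T \<U> (Suc n) =
    cover_join (iterated_join X T \<U> n) ((\<lambda>A. (T ^^ n) -` A \<inter> X) ` \<U>)"


definition open_cover :: "'a::topological_space set \<Rightarrow> 'a set set \<Rightarrow> bool" where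
  "open_cover X \<U> \<longleftrightarrow> (\<forall>U\<in>\<U>. openin (top_of_set X) U) \<and> \<Union>\<U> = X"

definition min_subcover_card :: "'a set \<Rightarrow> 'a set set \<Rightarrow> nat" where
  "min_subcover_card X \<U> = (LEAST k. \<exists>\<V>\<subseteq>\<U>. finite \<V> \<and> \<Union>\<V> = X \<and> card \<V> = k)"

text \<open>
  The limits defining the entropy of a cover and of a partition exist by subadditivity
  of \<open>n \<mapsto> ln (min_subcover_card X (iterated_join X T \<U> n))\<close> and of
  \<open>n \<mapsto> partition_entropy M (iterated_join (space M) T P n)\<close>.
\<close>
definition cover_entropy :: "'a set \<Rightarrow> ('a \<Rightarrow> 'a) \<Rightarrow> 'a set set \<Rightarrow> real" where
  "cover_entropy X T \<U> =
    lim (\<lambda>n. ln (real (min_subcover_card X (iterated_join X T \<U> n))) / real n)"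

definition topological_entropy :: "'a::metric_space set \<Rightarrow> ('a \<Rightarrow> 'a) \<Rightarrow> ereal" where
  "topological_entropy X T = (SUP \<U>\<in>{\<U>. open_cover X \<U>}. ereal (cover_entropy X T \<U>))"


definition ergodic_measure :: "'a::metric_space set \<Rightarrow> ('a \<Rightarrow> 'a) \<Rightarrow> 'a measure \<Rightarrow> bool" where
  "ergodic_measure X T M \<longleftrightarrow>
    prob_space M \<and> sets M = sets (restrict_space borel X) \<and>
    T \<in> M \<rightarrow>\<^sub>M M \<and> distr M M T = M \<and>
    (\<forall>A\<in>sets M. T -` A \<inter> space M = A \<longrightarrow> measure M A = 0 \<or> measure M A = 1)"

text \<open>Null sets contribute \<open>0\<close> to the sum, in accordance with the convention \<open>0 ln 0 = 0\<close>.\<close>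
definition partition_entropy :: "'a measure \<Rightarrow> 'a set set \<Rightarrow> real" where
  "partition_entropy M P = - (\<Sum>A\<in>P. measure M A * ln (measure M A))"

definition entropy_wrt_partition :: "'a measure \<Rightarrow> ('a \<Rightarrow> 'a) \<Rightarrow> 'a set set \<Rightarrow> real" where
  "entropy_wrt_partition M T P =
    lim (\<lambda>n. partition_entropy M (iterated_join (space M) T P n) / real n)"

definition measure_entropy :: "'a measure \<Rightarrow> ('a \<Rightarrow> 'a) \<Rightarrow> ereal" where
  "measure_entropy M T =
    (SUP P\<in>{P. finite P \<and> P \<subseteq> sets M \<and> partition_on (space M) P}.
      ereal (entropy_wrt_partition M T P))"

end

theory Submission
  imports Defs
begin

text \<open>
  Choose finite partitions \<open>\<alpha> 0, \<alpha> 1, \<dots>\<close> such that \<open>\<alpha> 0\<close> has positive entropy and the cells of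
  \<open>\<alpha> k\<close> have diameter below \<open>1 / k\<close> for \<open>k > 0\<close>. Two points whose \<open>\<alpha> k\<close>-names agree at all
  times after \<open>s k\<close>, for every \<open>k > 0\<close>, are asymptotic. If the delays \<open>s k\<close> grow fast enough, these
  names, together with the \<open>\<alpha> 0\<close>-name at all positive times, still leave \<open>\<alpha> 0\<close> at time \<open>0\<close>
  undetermined. So on a set of positive measure there are points with the same names
  but in different cells of \<open>\<alpha> 0\<close>, that is, proper asymptotic pairs; ergodicity spreads this over
  a set of full measure.

  The argument uses finite unions of cells and compactness only, hence it works for
  finitely additive invariant measures as well. These are easily obtained when only the
  topological entropy is known to be positive: take a limit, by Tychonoff's theorem, of
  orbit averages of uniform distributions on separated sets.
\<close>

section \<open>Shift-invariant submodular functions\<close>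

text \<open>Why suitable delays exist: a new row that is read only from a much later time on takes
  almost nothing from the rows already present, since otherwise the rows together would have a rate
  larger than their own rate. The chain rule passes this small loss on to the single coordinate
  \<open>(0, 0)\<close>, and geometrically decreasing budgets leave half of its entropy after all
  rows. The construction is in the spirit of the Rokhlin-Sinai partitions: a coding by the future
  that still has positive entropy given its own shift.

  The obstacle is the passage to infinitely many coordinates. A finitely additive measure gives no
  conditional measures on the fibres of an infinite coding, so the infinite coding never appears as
  a partition. Each finite stage yields pairs with equal names and different
  \<open>\<alpha> 0\<close>, and a limit of such pairs is taken. Limits respect names only where the
  cells are relatively clopen; this is why near continuity is carried along with every
  partition.\<close>

lemma cesaro_mean_tendsto:
  fixes d :: "nat \<Rightarrow> real"
  assumes "d \<longlonglongrightarrow> h"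
  shows "(\<lambda>n. (\<Sum>i<n. d i) / real n) \<longlonglongrightarrow> h"
proof (rule LIMSEQ_I)
  fix e :: real assume e: "e > 0"
  obtain N where N: "\<And>n. n \<ge> N \<Longrightarrow> \<bar>d n - h\<bar> < e / 2"
    using LIMSEQ_D[OF assms, of "e / 2"] e by auto
  define C where "C = (\<Sum>i<N. \<bar>d i - h\<bar>)"
  have C0: "C \<ge> 0" unfolding C_def by (simp add: sum_nonneg)
  obtain K :: nat where K: "real K > 2 * C / e" using reals_Archimedean2 by blast
  show "\<exists>no. \<forall>n\<ge>no. norm ((\<Sum>i<n. d i) / real n - h) < e"
  proof (intro exI allI impI)
    fix n assume n: "n \<ge> Suc (max N K)"
    have npos: "real n > 0" using n by simp
    have "\<bar>(\<Sum>i<n. d i) - real n * h\<bar> = \<bar>\<Sum>i<n. (d i - h)\<bar>"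
      by (simp add: sum_subtractf)
    also have "\<dots> \<le> (\<Sum>i<n. \<bar>d i - h\<bar>)" by (rule sum_abs)
    also have "\<dots> = C + (\<Sum>i\<in>{N..<n}. \<bar>d i - h\<bar>)"
      unfolding C_def lessThan_atLeast0 using n by (subst sum.atLeastLessThan_concat) auto
    also have "(\<Sum>i\<in>{N..<n}. \<bar>d i - h\<bar>) \<le> (\<Sum>i\<in>{N..<n}. e / 2)"
      by (rule sum_mono) (use N in \<open>auto intro: less_imp_le\<close>)
    also have "\<dots> \<le> real n * (e / 2)" using e by (auto intro!: mult_right_mono)
    finally have 1: "\<bar>(\<Sum>i<n. d i) - real n * h\<bar> \<le> C + real n * (e / 2)" by simp
    have "real n > 2 * C / e" using K n by linarith
    hence "C < real n * (e / 2)" using e by (simp add: field_simps)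
    with 1 have "\<bar>(\<Sum>i<n. d i) - real n * h\<bar> < real n * e" by linarith
    hence "\<bar>(\<Sum>i<n. d i) - real n * h\<bar> / real n < e"
      using npos by (simp add: divide_less_eq mult.commute)
    moreover have "(\<Sum>i<n. d i) / real n - h = ((\<Sum>i<n. d i) - real n * h) / real n"
      using npos by (simp add: field_simps)
    ultimately show "norm ((\<Sum>i<n. d i) / real n - h) < e" by (simp add: abs_divide)
  qed
qed

text \<open>The pair \<open>(k, n)\<close> stands for the coordinate \<open>\<alpha> k \<circ> T ^^ n\<close> of a coding.\<close>
definition tshift :: "nat \<Rightarrow> (nat \<times> nat) set \<Rightarrow> (nat \<times> nat) set" where
  "tshift t I = (\<lambda>(k, n). (k, n + t)) ` I"

text \<open>If \<open>A\<close> is read as the partition it codes, this is the join of its preimages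
  under \<open>T ^^ t\<close> for \<open>i \<le> t < j\<close>. In particular
  \<open>block A 1 L\<close> is a finite piece of the strict future of \<open>A\<close>.\<close>

definition block :: "(nat \<times> nat) set \<Rightarrow> nat \<Rightarrow> nat \<Rightarrow> (nat \<times> nat) set" where
  "block A i j = (\<Union>t\<in>{i..<j}. tshift t A)"

lemma shift_0 [simp]: "tshift 0 I = I"
  unfolding tshift_def by (auto simp: image_iff)

lemma shift_shift: "tshift s (tshift t I) = tshift (t + s) I"
  unfolding tshift_def image_image by (rule image_cong) auto

lemma mem_tshift: "(k, n) \<in> tshift i I \<longleftrightarrow> (\<exists>n'. n = n' + i \<and> (k, n') \<in> I)"
  by (force simp: tshift_def)

lemma finite_shift [simp]: "finite I \<Longrightarrow> finite (tshift t I)"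
  unfolding tshift_def by simp

lemma shift_Un: "tshift t (I \<union> J) = tshift t I \<union> tshift t J"
  unfolding tshift_def by auto

lemma finite_block [simp]: "finite A \<Longrightarrow> finite (block A i j)"
  unfolding block_def by simp

lemma block_mono: "A \<subseteq> A' \<Longrightarrow> i' \<le> i \<Longrightarrow> j \<le> j' \<Longrightarrow> block A i j \<subseteq> block A' i' j'"
  unfolding block_def tshift_def by (fastforce)

lemma block_Un: "block (A \<union> B) i j = block A i j \<union> block B i j"
  unfolding block_def by (auto simp: shift_Un)

lemma block_split: "i \<le> j \<Longrightarrow> j \<le> k \<Longrightarrow> block A i k = block A i j \<union> block A j k"
  unfolding block_def by (simp add: UN_Un [symmetric] ivl_disj_un)

lemma block_Suc_left: "i < j \<Longrightarrow> block A i j = tshift i A \<union> block A (Suc i) j"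
proof -
  assume "i < j"
  hence "{i..<j} = insert i {Suc i..<j}" by auto
  thus ?thesis by (simp add: block_def)
qed

lemma shift_block: "tshift t (block A i j) = block A (i + t) (j + t)"
proof -
  have "tshift t (block A i j) = (\<Union>s\<in>{i..<j}. tshift (s + t) A)"
  proof -
    have "tshift t (\<Union>s\<in>{i..<j}. tshift s A) = (\<Union>s\<in>{i..<j}. tshift t (tshift s A))"
      unfolding tshift_def by (rule image_UN)
    thus ?thesis by (simp add: block_def shift_shift)
  qed
  also have "\<dots> = (\<Union>s\<in>(\<lambda>s. s + t) ` {i..<j}. tshift s A)" by (simp only: image_image)
  also have "\<dots> = block A (i + t) (j + t)" unfolding block_def by (subst image_add_atLeastLessThan') (rule refl)
  finally show ?thesis .
qed

lemma mem_block_singleton: "i \<le> t \<Longrightarrow> t < j \<Longrightarrow> (k, n) \<in> A \<Longrightarrow> (k, n + t) \<in> block A i j"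
  unfolding block_def tshift_def by force

text \<open>These are the properties of the joint Shannon entropy of coordinates of a stationary
  process. The delays are found from them alone, without reference to a measure.\<close>

locale shift_submodular =
  fixes H :: "(nat \<times> nat) set \<Rightarrow> real"
  assumes H_empty: "H {} = 0"
    and H_mono: "finite J \<Longrightarrow> I \<subseteq> J \<Longrightarrow> H I \<le> H J"
    and H_submod: "finite I \<Longrightarrow> finite J \<Longrightarrow> H (I \<union> J) + H (I \<inter> J) \<le> H I + H J"
    and H_shift1: "finite I \<Longrightarrow> H (tshift 1 I) = H I"
begin

lemma H_shift: "finite I \<Longrightarrow> H (tshift t I) = H I"
proof (induction t)
  case (Suc t)
  have "tshift (Suc t) I = tshift 1 (tshift t I)" by (simp add: shift_shift)
  thus ?case using Suc H_shift1 by simp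
qed simp

section \<open>Conditional entropy and entropy rate\<close>

definition cond :: "(nat \<times> nat) set \<Rightarrow> (nat \<times> nat) set \<Rightarrow> real" where
  "cond I J = H (I \<union> J) - H J"

text \<open>The entropy of \<open>A\<close> given its strict future, that is, the Kolmogorov-Sinai
  entropy of the partition coded by \<open>A\<close>. The terms decrease in \<open>L\<close>, so the
  infimum is their limit.\<close>

definition rate :: "(nat \<times> nat) set \<Rightarrow> real" where
  "rate A = (INF L. cond A (block A 1 L))"

lemma cond_nonneg: "finite I \<Longrightarrow> finite J \<Longrightarrow> cond I J \<ge> 0"
  unfolding cond_def using H_mono[of "I \<union> J" J] by auto

text \<open>Submodularity for \<open>I \<union> J\<close> and \<open>J'\<close>. Their intersection
  may be larger than \<open>J\<close>; monotonicity absorbs the difference.\<close>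

lemma cond_antimono:
  assumes "finite I" "finite J'" "J \<subseteq> J'"
  shows "cond I J' \<le> cond I J"
proof -
  have fJ: "finite J" using assms finite_subset by blast
  have "H ((I \<union> J) \<union> J') + H ((I \<union> J) \<inter> J') \<le> H (I \<union> J) + H J'"
    using assms fJ by (intro H_submod) auto
  moreover have "H J \<le> H ((I \<union> J) \<inter> J')" using assms by (intro H_mono) auto
  moreover have "(I \<union> J) \<union> J' = I \<union> J'" using assms by auto
  ultimately show ?thesis unfolding cond_def by simp
qed

lemma cond_chain: "cond (I \<union> I') J = cond I J + cond I' (I \<union> J)"
  unfolding cond_def by (simp add: Un_ac)

lemma cond_shift: "finite I \<Longrightarrow> finite J \<Longrightarrow> cond (tshift t I) (tshift t J) = cond I J"
  unfolding cond_def using H_shift by (simp flip: shift_Un)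

context
  fixes A :: "(nat \<times> nat) set" assumes finA: "finite A"
begin

lemma bdd_below_cond: "bdd_below (range (\<lambda>L. cond A (block A 1 L)))"
  by (rule bdd_belowI2[where m = 0]) (rule cond_nonneg[OF finA finite_block[OF finA]])

lemma rate_le: "rate A \<le> cond A (block A 1 L)"
  unfolding rate_def by (rule cINF_lower[OF bdd_below_cond]) simp

lemma rate_attained: "e > 0 \<Longrightarrow> \<exists>L. cond A (block A 1 L) < rate A + e"
  using cINF_less_iff[OF _ bdd_below_cond, of "rate A + e"] unfolding rate_def by simp

text \<open>Time 0 is split off rather than the last time: the rest is a shift of
  \<open>block A 0 n\<close>, and the increment is conditioned on the strict future, as in
  \<open>rate\<close>.\<close>

lemma H_block_Suc: "H (block A 0 (Suc n)) = H (block A 0 n) + cond A (block A 1 (Suc n))"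
proof -
  have "block A 1 (Suc n) = tshift 1 (block A 0 n)" by (simp add: shift_block)
  hence "H (block A 1 (Suc n)) = H (block A 0 n)" using finA by (metis H_shift finite_block)
  moreover have "block A 0 (Suc n) = A \<union> block A 1 (Suc n)"
    using block_Suc_left[of 0 "Suc n" A] by simp
  ultimately show ?thesis unfolding cond_def by simp
qed

lemma H_block: "H (block A 0 n) = (\<Sum>l<n. cond A (block A 1 (Suc l)))"
  by (induction n) (simp_all only: H_block_Suc sum.lessThan_Suc, simp add: block_def H_empty)

lemma cond_block_tendsto: "(\<lambda>L. cond A (block A 1 (Suc L))) \<longlonglongrightarrow> rate A"
proof (rule LIMSEQ_I)
  fix e :: real assume "e > 0"
  then obtain L where L: "cond A (block A 1 L) < rate A + e" using rate_attained by blast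
  show "\<exists>no. \<forall>n\<ge>no. norm (cond A (block A 1 (Suc n)) - rate A) < e"
  proof (intro exI allI impI)
    fix n assume "n \<ge> L"
    hence "cond A (block A 1 (Suc n)) \<le> cond A (block A 1 L)"
      using finA by (intro cond_antimono block_mono) auto
    thus "norm (cond A (block A 1 (Suc n)) - rate A) < e"
      using L rate_le[of "Suc n"] by simp
  qed
qed

lemma H_block_tendsto: "(\<lambda>n. H (block A 0 n) / real n) \<longlonglongrightarrow> rate A"
  unfolding H_block by (rule cesaro_mean_tendsto) (rule cond_block_tendsto)

lemma H_block_diff_ge: "H (block A 0 (n + k)) - H (block A 0 n) \<ge> real k * rate A"
proof (induction k)
  case (Suc k)
  thus ?case using H_block_Suc[of "n + k"] rate_le[of "Suc (n + k)"] by (simp add: algebra_simps)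
qed simp

end

text \<open>Otherwise the rows \<open>A\<close>, read over \<open>N\<close> steps given the future of \<open>A \<union> B\<close>, would contribute less than
  \<open>N * (rate A - e)\<close>, and the rows \<open>B\<close> could only make up for this if \<open>A \<union> B\<close> had rate at least
  \<open>rate (A \<union> B) + e\<close>.\<close>
lemma cond_delayed_row:
  assumes finA: "finite A" and finB: "finite B" and e: "e > 0"
  shows "\<exists>n. \<forall>L. cond A (block A 1 L \<union> block B n L) \<ge> rate A - e"
proof (rule ccontr)
  assume "\<not> ?thesis"
  hence "\<forall>n. \<exists>L. cond A (block A 1 L \<union> block B n L) < rate A - e" by (auto simp: not_le)
  then obtain Lf where Lf: "\<And>n. cond A (block A 1 (Lf n) \<union> block B n (Lf n)) < rate A - e"
    by metis
  define C where "C = A \<union> B"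
  have finC: "finite C" using finA finB by (simp add: C_def)
  have key: "H (block C 0 N) \<ge> real N * (rate C + e)" for N
  proof -
    \<comment> \<open>A common horizon: for every \<open>t \<le> N\<close> the remaining window of
      length \<open>M - t\<close> contains the window \<open>Lf (N - t)\<close> on which the negated
      claim speaks.\<close>
    define M where "M = N + (\<Sum>n\<le>N. Lf n)"
    have MN: "N \<le> M" by (simp add: M_def)
    have M: "M - t \<ge> Lf (N - t)" if "t \<le> N" for t
    proof -
      have "Lf (N - t) \<le> (\<Sum>n\<le>N. Lf n)"
        by (rule member_le_sum) auto
      thus ?thesis using that by (simp add: M_def)
    qed
    define J where "J = block A N M \<union> block B N M"
    have finJ: "finite J" using finA finB by (simp add: J_def)
    have JC: "block C N M = J" by (simp add: J_def C_def block_Un)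
    \<comment> \<open>Seen from time \<open>t\<close>, the rows \<open>B\<close> in \<open>J\<close>
      begin \<open>N - t\<close> steps ahead. Shifting back by \<open>t\<close> gives the negated
      claim for delay \<open>N - t\<close>.\<close>
    have step: "H (block A t N \<union> J) - H (block A (Suc t) N \<union> J) \<le> rate A - e" if t: "t < N" for t
    proof -
      have 1: "block A t N \<union> J = tshift t A \<union> (block A (Suc t) N \<union> J)"
        using block_Suc_left[OF t, of A] by auto
      have 2: "block A (Suc t) N \<union> J = block A (Suc t) M \<union> block B N M"
        using block_split[of "Suc t" N M A] t MN by (auto simp: J_def)
      have 3: "block A (Suc t) M \<union> block B N M
          = tshift t (block A 1 (M - t) \<union> block B (N - t) (M - t))"
        using t MN by (simp add: shift_Un shift_block)
      have "H (block A t N \<union> J) - H (block A (Suc t) N \<union> J)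
          = cond (tshift t A) (tshift t (block A 1 (M - t) \<union> block B (N - t) (M - t)))"
        unfolding cond_def 1 2 3 ..
      also have "\<dots> = cond A (block A 1 (M - t) \<union> block B (N - t) (M - t))"
        using finA finB by (intro cond_shift) auto
      also have "\<dots> \<le> cond A (block A 1 (Lf (N - t)) \<union> block B (N - t) (Lf (N - t)))"
        using finA finB M[of t] t by (intro cond_antimono Un_mono block_mono) auto
      also have "\<dots> \<le> rate A - e" using Lf less_imp_le by blast
      finally show ?thesis .
    qed
    have tel: "H (block A (N - k) N \<union> J) - H J \<le> real k * (rate A - e)" if "k \<le> N" for k
      using that
    proof (induction k)
      case 0 thus ?case by (simp add: block_def)
    next
      case (Suc k)
      have "Suc (N - Suc k) = N - k" using Suc by simp
      with step[of "N - Suc k"] Suc show ?case by (simp add: algebra_simps)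
    qed
    have a: "H (block A 0 N \<union> J) - H J \<le> real N * (rate A - e)" using tel[of N] by simp
    have "cond (block B 0 N) (block A 0 N \<union> J) \<le> cond (block B 0 N) (block A 0 N)"
      using finA finB finJ by (intro cond_antimono) auto
    moreover have "block B 0 N \<union> (block A 0 N \<union> J) = block C 0 M"
      using block_split[of 0 N M C] MN JC by (auto simp: C_def block_Un)
    moreover have "block B 0 N \<union> block A 0 N = block C 0 N" by (auto simp: C_def block_Un)
    ultimately have b: "H (block C 0 M) - H (block A 0 N \<union> J) \<le> H (block C 0 N) - H (block A 0 N)"
      unfolding cond_def by simp
    have c: "H (block A 0 N) \<ge> real N * rate A"
      using H_block_diff_ge[OF finA, where n = 0 and k = N] by (simp add: block_def H_empty)
    have "J = tshift N (block C 0 (M - N))" using MN JC by (simp add: shift_block)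
    hence "H J = H (block C 0 (M - N))" using finC by (metis H_shift finite_block)
    hence d: "H (block C 0 M) - H J \<ge> real N * rate C"
      using H_block_diff_ge[OF finC, of N "M - N"] MN by simp
    \<comment> \<open>Facts \<open>a\<close> and \<open>b\<close> bound
      \<open>H (block C 0 M) - H J\<close> from above and \<open>d\<close> bounds it from below. By
      \<open>c\<close> the terms with \<open>rate A\<close> cancel, and the gain
      \<open>N * e\<close> remains.\<close>
    from a b c d show ?thesis by (simp add: algebra_simps)
  qed
  have "rate C + e \<le> rate C"
  proof (rule LIMSEQ_le_const[OF H_block_tendsto[OF finC]], intro exI allI impI)
    fix n :: nat assume "1 \<le> n"
    thus "rate C + e \<le> H (block C 0 n) / real n" using key[of n] by (simp add: field_simps)
  qed
  thus False using e by simp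
qed

text \<open>By the chain rule \<open>cond A D\<close> is the contribution of \<open>(0, 0)\<close>
  plus that of \<open>A\<close> given \<open>(0, 0)\<close>. The delayed row lowers the sum by at
  most \<open>e / 2\<close>, and the second summand is at most \<open>rate A + e / 2 - c\<close>; so
  the first one is at least \<open>c - e\<close>.\<close>

lemma cond_add_row:
  assumes finA: "finite A" and "(0, 0) \<in> A" and e: "e > 0"
    and c: "\<And>L. cond {(0, 0)} (block A 1 L) \<ge> c"
  shows "\<exists>s. \<forall>L. cond {(0, 0)} (block (insert (k, s) A) 1 L) \<ge> c - e"
proof -
  let ?O = "{(0, 0)} :: (nat \<times> nat) set" and ?B = "{(k, 0)} :: (nat \<times> nat) set"
  obtain n where n: "\<And>L. cond A (block A 1 L \<union> block ?B n L) \<ge> rate A - e / 2"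
    using cond_delayed_row[OF finA, of ?B "e / 2"] e by auto
  obtain L' where L': "cond A (block A 1 L') < rate A + e / 2"
    using rate_attained[OF finA, of "e / 2"] e by auto
  have OA: "?O \<union> A = A" using assms by auto
  show ?thesis
  proof (intro exI[of _ n] allI)
    fix L
    \<comment> \<open>Long enough for the row \<open>A\<close> over both \<open>L\<close> and
      \<open>L'\<close> steps, and for the new row, which is read up to time
      \<open>n + L\<close>.\<close>
    define L2 where "L2 = L + L' + n"
    define D where "D = block A 1 L2 \<union> block ?B n L2"
    have finD: "finite D" using finA by (simp add: D_def)
    have "cond A (?O \<union> D) \<le> cond A (?O \<union> block A 1 L')"
      using finA by (intro cond_antimono) (auto simp: D_def L2_def intro: block_mono[THEN subsetD, rotated -1])
    also have "\<dots> = cond A (block A 1 L') - cond ?O (block A 1 L')"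
      using cond_chain[of ?O A "block A 1 L'"] OA by simp
    also have "\<dots> \<le> rate A + e / 2 - c" using L' c[of L'] by simp
    finally have "cond A (?O \<union> D) \<le> rate A + e / 2 - c" .
    moreover have "cond A D = cond ?O D + cond A (?O \<union> D)"
      using cond_chain[of ?O A D] OA by simp
    moreover have "cond A D \<ge> rate A - e / 2" using n by (simp add: D_def)
    ultimately have "cond ?O D \<ge> c - e" by (simp add: field_simps)
    moreover have "cond ?O D \<le> cond ?O (block (insert (k, n) A) 1 L)"
    proof (rule cond_antimono)
      have "block {(k, n)} 1 L \<subseteq> block ?B n L2"
      proof
        fix z assume "z \<in> block {(k, n)} 1 L"
        then obtain t where t: "1 \<le> t" "t < L" "z = (k, n + t)" by (auto simp: block_def tshift_def)
        thus "z \<in> block ?B n L2"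
          using mem_block_singleton[of n "n + t" L2 k 0 ?B] by (simp add: L2_def)
      qed
      moreover have "block A 1 L \<subseteq> block A 1 L2" by (rule block_mono) (auto simp: L2_def)
      moreover have "insert (k, n) A = {(k, n)} \<union> A" by simp
      ultimately show "block (insert (k, n) A) 1 L \<subseteq> D" unfolding D_def
        by (simp only: block_Un) blast
    qed (use finD in auto)
    ultimately show "cond ?O (block (insert (k, n) A) 1 L) \<ge> c - e" by linarith
  qed
qed

lemma exists_delays:
  assumes pos: "rate {(0, 0)} > 0"
  shows "\<exists>s. \<forall>k L. cond {(0, 0)} (block ((\<lambda>j. (j, s j)) ` {..k}) 1 L) \<ge> rate {(0, 0)} / 2"
proof -
  let ?O = "{(0, 0)} :: (nat \<times> nat) set"
  define h where "h = rate ?O"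
  \<comment> \<open>The budget: \<open>c 0 = h\<close>, the row \<open>Suc k\<close> may cost
    \<open>h / 2 ^ Suc (Suc k)\<close>, and \<open>c k\<close> never falls below
    \<open>h / 2\<close>.\<close>
  define c where "c k = h / 2 + h / 2 ^ Suc k" for k :: nat
  define P where "P k A \<longleftrightarrow> finite A \<and> (0, 0) \<in> A \<and> (\<forall>L. cond ?O (block A 1 L) \<ge> c k)"
    for k :: nat and A
  have "\<exists>A. \<forall>k. P k (A k) \<and> (\<exists>s. A (Suc k) = insert (Suc k, s) (A k)) \<and> (A 0 = ?O)"
  proof -
    have "\<exists>f. \<forall>k. (P k (f k) \<and> (k = 0 \<longrightarrow> f k = ?O)) \<and> (\<exists>s. f (Suc k) = insert (Suc k, s) (f k))"
    proof (rule dependent_nat_choice)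
      show "\<exists>x. P 0 x \<and> (0 = (0::nat) \<longrightarrow> x = ?O)"
        using rate_le[of ?O] by (auto simp: P_def c_def h_def)
    next
      fix A k assume A: "P k A \<and> (k = 0 \<longrightarrow> A = ?O)"
      have "h / 2 ^ Suc (Suc k) > 0" using pos by (simp add: h_def)
      then obtain s where "\<forall>L. cond ?O (block (insert (Suc k, s) A) 1 L) \<ge> c k - h / 2 ^ Suc (Suc k)"
        using cond_add_row[of A _ "c k" "Suc k"] A unfolding P_def by blast
      moreover have "c k - h / 2 ^ Suc (Suc k) = c (Suc k)" by (simp add: c_def field_simps)
      ultimately show "\<exists>y. (P (Suc k) y \<and> (Suc k = 0 \<longrightarrow> y = ?O)) \<and> (\<exists>s. y = insert (Suc k, s) A)"
        using A by (intro exI[of _ "insert (Suc k, s) A"]) (auto simp: P_def)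
    qed
    thus ?thesis by metis
  qed
  then obtain A s where A: "\<And>k. P k (A k)" "\<And>k. A (Suc k) = insert (Suc k, s k) (A k)" "A 0 = ?O"
    by metis
  \<comment> \<open>Row 0 is the starting set \<open>{(0, 0)}\<close> and has delay 0. As blocks
    start at 1, it is read at all positive times.\<close>
  define s' where "s' k = (case k of 0 \<Rightarrow> 0 | Suc k \<Rightarrow> s k)" for k
  have "A k = (\<lambda>j. (j, s' j)) ` {..k}" for k
    by (induction k) (simp_all add: A s'_def atMost_Suc)
  hence "cond ?O (block ((\<lambda>j. (j, s' j)) ` {..k}) 1 L) \<ge> c k" for k L
    using A(1)[of k] by (simp add: P_def)
  moreover have "c k \<ge> h / 2" for k using pos by (simp add: c_def h_def)
  ultimately show ?thesis unfolding h_def by (meson order_trans)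
qed

end

section \<open>Entropy of finitely additive measures\<close>

definition eta :: "real \<Rightarrow> real" where
  "eta p = - (p * ln p)"

lemma eta_0 [simp]: "eta 0 = 0" and eta_1 [simp]: "eta 1 = 0"
  by (simp_all add: eta_def)

lemma eta_nonneg: "0 \<le> p \<Longrightarrow> p \<le> 1 \<Longrightarrow> 0 \<le> eta p"
  by (cases "p = 0") (auto simp: eta_def mult_nonneg_nonpos)

text \<open>The right-hand side is the tangent to the concave function \<open>eta\<close> at
  \<open>q\<close>. Both submodularity and the inequality for averages are drawn from it.\<close>

lemma eta_le_tangent:
  assumes "0 \<le> p" "0 < q"
  shows "eta p \<le> - p * ln q + (q - p)"
proof (cases "p = 0")
  case False
  hence p: "p > 0" using assms by simp
  have "ln (q / p) \<le> q / p - 1" using p assms by (intro ln_le_minus_one) simp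
  hence "p * ln (q / p) \<le> p * (q / p - 1)" using p by (intro mult_left_mono) auto
  thus ?thesis using p assms by (simp add: eta_def ln_div algebra_simps)
qed (use assms in simp)

lemma eta_le_compl: "0 \<le> p \<Longrightarrow> eta p \<le> 1 - p"
  using eta_le_tangent[of p 1] by simp

text \<open>An explicit modulus of continuity at 0, where \<open>eta\<close> has infinite slope. It
  comes from \<open>ln y \<le> y - 1\<close> at \<open>y = 1 / sqrt p\<close>.\<close>

lemma eta_le_sqrt:
  assumes "0 \<le> p"
  shows "eta p \<le> 2 * sqrt p"
proof (cases "p = 0")
  case False
  hence p: "p > 0" using assms by simp
  have "ln (1 / sqrt p) \<le> 1 / sqrt p - 1" using p by (intro ln_le_minus_one) simp
  hence "- ln p / 2 \<le> 1 / sqrt p" using p by (simp add: ln_div ln_sqrt)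
  hence "p * (- ln p / 2) \<le> p * (1 / sqrt p)" using p by (intro mult_left_mono) auto
  also have "p * (1 / sqrt p) = sqrt p" using p by (simp add: real_div_sqrt)
  finally show ?thesis by (simp add: eta_def)
qed simp

lemma sum_rotate3:
  "(\<Sum>u\<in>U. \<Sum>v\<in>V. \<Sum>w\<in>W. g u v w) = (\<Sum>w\<in>W. \<Sum>u\<in>U. \<Sum>v\<in>V. g u v w)"
proof -
  have "(\<Sum>v\<in>V. \<Sum>w\<in>W. g u v w) = (\<Sum>w\<in>W. \<Sum>v\<in>V. g u v w)" for u by (rule sum.swap)
  hence "(\<Sum>u\<in>U. \<Sum>v\<in>V. \<Sum>w\<in>W. g u v w) = (\<Sum>u\<in>U. \<Sum>w\<in>W. \<Sum>v\<in>V. g u v w)" by simp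
  also have "\<dots> = (\<Sum>w\<in>W. \<Sum>u\<in>U. \<Sum>v\<in>V. g u v w)" by (rule sum.swap)
  finally show ?thesis .
qed

text \<open>Nonnegativity of conditional mutual information. With the marginals \<open>a\<close>,
  \<open>b\<close>, \<open>c\<close>, each \<open>p u v w\<close> is compared with its conditionally
  independent value \<open>a u w * b v w / c w\<close> by the tangent inequality; both families have
  the same total, so the linear terms cancel.\<close>

lemma sum_eta_submodular:
  fixes p :: "'b \<Rightarrow> 'c \<Rightarrow> 'd \<Rightarrow> real"
  assumes fin: "finite U" "finite V" "finite W"
    and nonneg: "\<And>u v w. p u v w \<ge> 0"
  shows "(\<Sum>u\<in>U. \<Sum>v\<in>V. \<Sum>w\<in>W. eta (p u v w)) + (\<Sum>w\<in>W. eta (\<Sum>u\<in>U. \<Sum>v\<in>V. p u v w))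
    \<le> (\<Sum>u\<in>U. \<Sum>w\<in>W. eta (\<Sum>v\<in>V. p u v w)) + (\<Sum>v\<in>V. \<Sum>w\<in>W. eta (\<Sum>u\<in>U. p u v w))"
proof -
  define a where "a u w = (\<Sum>v\<in>V. p u v w)" for u w
  define b where "b v w = (\<Sum>u\<in>U. p u v w)" for v w
  define c where "c w = (\<Sum>u\<in>U. \<Sum>v\<in>V. p u v w)" for w
  have ca: "c w = (\<Sum>u\<in>U. a u w)" for w by (simp add: c_def a_def)
  have cb: "c w = (\<Sum>v\<in>V. b v w)" for w unfolding c_def b_def by (rule sum.swap)
  have a0: "a u w \<ge> 0" and b0: "b v w \<ge> 0" for u v w
    by (auto simp: a_def b_def nonneg intro!: sum_nonneg)
  have c0: "c w \<ge> 0" for w by (simp add: ca a0 sum_nonneg)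
  have pt: "p u v w * (- ln (p u v w) - ln (c w) + ln (a u w) + ln (b v w))
      \<le> a u w * b v w / c w - p u v w" if uv: "u \<in> U" "v \<in> V" for u v w
  \<comment> \<open>Here \<open>c w\<close> may vanish as well; division by 0 gives 0, so the
    right-hand side is still nonnegative. The same convention makes
    \<open>c w * c w / c w = c w\<close> hold below for all \<open>w\<close>.\<close>
  proof (cases "p u v w = 0")
    case True
    thus ?thesis using a0 b0 c0 by simp
  next
    case False
    hence p: "p u v w > 0" using nonneg[of u v w] by simp
    have pa: "p u v w \<le> a u w" unfolding a_def
      using uv fin nonneg by (intro member_le_sum) auto
    have pb: "p u v w \<le> b v w" unfolding b_def
      using uv fin nonneg by (intro member_le_sum[where f = "\<lambda>u. p u v w"]) auto
    have ac: "a u w \<le> c w" unfolding ca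
      using uv fin a0 by (intro member_le_sum[where f = "\<lambda>u. a u w"]) auto
    have pos: "a u w > 0" "b v w > 0" "c w > 0" using p pa pb ac by linarith+
    have "eta (p u v w) \<le> - p u v w * ln (a u w * b v w / c w) + (a u w * b v w / c w - p u v w)"
      using p pos by (intro eta_le_tangent) auto
    thus ?thesis using pos p by (simp add: eta_def ln_div ln_mult algebra_simps)
  qed
  have "(\<Sum>u\<in>U. \<Sum>v\<in>V. \<Sum>w\<in>W. p u v w * (- ln (p u v w) - ln (c w) + ln (a u w) + ln (b v w)))
     \<le> (\<Sum>u\<in>U. \<Sum>v\<in>V. \<Sum>w\<in>W. a u w * b v w / c w - p u v w)"
    by (intro sum_mono pt)
  also have "\<dots> = (\<Sum>w\<in>W. \<Sum>u\<in>U. \<Sum>v\<in>V. a u w * b v w / c w - p u v w)"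
    by (rule sum_rotate3)
  also have "\<dots> = (\<Sum>w\<in>W. c w * c w / c w - c w)"
  proof (rule sum.cong[OF refl])
    fix w
    have "(\<Sum>u\<in>U. \<Sum>v\<in>V. a u w * b v w / c w) = (\<Sum>u\<in>U. a u w) * (\<Sum>v\<in>V. b v w) / c w"
      by (simp add: sum_product sum_divide_distrib)
    thus "(\<Sum>u\<in>U. \<Sum>v\<in>V. a u w * b v w / c w - p u v w) = c w * c w / c w - c w"
      by (simp add: sum_subtractf ca[symmetric] cb[symmetric]) (simp add: c_def)
  qed
  also have "\<dots> = 0" by (intro sum.neutral) auto
  finally have main: "(\<Sum>u\<in>U. \<Sum>v\<in>V. \<Sum>w\<in>W. p u v w * (- ln (p u v w) - ln (c w) + ln (a u w) + ln (b v w))) \<le> 0" .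
  have "(\<Sum>u\<in>U. \<Sum>v\<in>V. \<Sum>w\<in>W. p u v w * (- ln (p u v w) - ln (c w) + ln (a u w) + ln (b v w)))
     = (\<Sum>u\<in>U. \<Sum>v\<in>V. \<Sum>w\<in>W. eta (p u v w)) - (\<Sum>u\<in>U. \<Sum>v\<in>V. \<Sum>w\<in>W. p u v w * ln (c w))
      + (\<Sum>u\<in>U. \<Sum>v\<in>V. \<Sum>w\<in>W. p u v w * ln (a u w)) + (\<Sum>u\<in>U. \<Sum>v\<in>V. \<Sum>w\<in>W. p u v w * ln (b v w))"
    by (simp add: eta_def algebra_simps sum.distrib sum_subtractf sum_negf)
  moreover have "(\<Sum>u\<in>U. \<Sum>v\<in>V. \<Sum>w\<in>W. p u v w * ln (c w)) = - (\<Sum>w\<in>W. eta (c w))"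
  proof -
    have "(\<Sum>u\<in>U. \<Sum>v\<in>V. \<Sum>w\<in>W. p u v w * ln (c w)) = (\<Sum>w\<in>W. \<Sum>u\<in>U. \<Sum>v\<in>V. p u v w * ln (c w))"
      by (rule sum_rotate3)
    also have "\<dots> = - (\<Sum>w\<in>W. eta (c w))"
      by (simp add: eta_def sum_negf c_def sum_distrib_right)
    finally show ?thesis .
  qed
  moreover have "(\<Sum>u\<in>U. \<Sum>v\<in>V. \<Sum>w\<in>W. p u v w * ln (a u w)) = - (\<Sum>u\<in>U. \<Sum>w\<in>W. eta (a u w))"
  proof -
    have "(\<Sum>v\<in>V. \<Sum>w\<in>W. p u v w * ln (a u w)) = - (\<Sum>w\<in>W. eta (a u w))" for u
      unfolding sum.swap[of _ W V] by (simp add: eta_def sum_negf a_def sum_distrib_right)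
    thus ?thesis by (simp add: sum_negf)
  qed
  moreover have "(\<Sum>u\<in>U. \<Sum>v\<in>V. \<Sum>w\<in>W. p u v w * ln (b v w)) = - (\<Sum>v\<in>V. \<Sum>w\<in>W. eta (b v w))"
  proof -
    have "(\<Sum>u\<in>U. \<Sum>v\<in>V. \<Sum>w\<in>W. p u v w * ln (b v w)) = (\<Sum>v\<in>V. \<Sum>w\<in>W. \<Sum>u\<in>U. p u v w * ln (b v w))"
      by (rule sum_rotate3[symmetric])
    also have "\<dots> = - (\<Sum>v\<in>V. \<Sum>w\<in>W. eta (b v w))"
      by (simp add: eta_def sum_negf b_def sum_distrib_right)
    finally show ?thesis .
  qed
  ultimately show ?thesis using main by (simp add: a_def b_def c_def)
qed

section \<open>Entropy of the partition into fibres of a function\<close>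

definition fa_entropy :: "'a set \<Rightarrow> ('a set \<Rightarrow> real) \<Rightarrow> ('a \<Rightarrow> 'b) \<Rightarrow> real" where
  "fa_entropy X m f = (\<Sum>v\<in>f ` X. eta (m {x \<in> X. f x = v}))"

definition fibres :: "'a set \<Rightarrow> ('a \<Rightarrow> 'b) \<Rightarrow> 'a set set" where
  "fibres X f = (\<lambda>x. {y \<in> X. f y = f x}) ` X"

lemma fa_entropy_fibres: "fa_entropy X m f = (\<Sum>A\<in>fibres X f. eta (m A))"
proof -
  have "inj_on (\<lambda>v. {x \<in> X. f x = v}) (f ` X)" by (auto simp: inj_on_def)
  moreover have "fibres X f = (\<lambda>v. {x \<in> X. f x = v}) ` f ` X"
    by (auto simp: fibres_def)
  ultimately show ?thesis by (simp add: fa_entropy_def sum.reindex)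
qed

text \<open>Entropy depends only on the fibres. Hence partitions can be coded by functions of any
  type, joins by pairs, and codings can be exchanged freely when they identify the same
  points.\<close>

lemma fa_entropy_kernel:
  assumes "\<And>x y. x \<in> X \<Longrightarrow> y \<in> X \<Longrightarrow> f x = f y \<longleftrightarrow> g x = g y"
  shows "fa_entropy X m f = fa_entropy X m g"
proof -
  have "fibres X f = fibres X g" unfolding fibres_def
    using assms by (intro image_cong) auto
  thus ?thesis by (simp add: fa_entropy_fibres)
qed

lemma fa_entropy_superset:
  assumes "finite V" "f ` X \<subseteq> V" "m {} = 0"
  shows "fa_entropy X m f = (\<Sum>v\<in>V. eta (m {x \<in> X. f x = v}))"
  unfolding fa_entropy_def
proof (rule sum.mono_neutral_left)
  show "\<forall>v\<in>V - f ` X. eta (m {x \<in> X. f x = v}) = 0"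
  proof
    fix v assume "v \<in> V - f ` X"
    hence "{x \<in> X. f x = v} = {}" by auto
    thus "eta (m {x \<in> X. f x = v}) = 0" using assms(3) by (metis eta_0)
  qed
qed (use assms in auto)

lemma fa_entropy_comp:
  assumes "finite (f ` X)" "S ` X \<subseteq> X" "m {} = 0"
  shows "fa_entropy X m (\<lambda>x. f (S x)) = fa_entropy X (\<lambda>A. m (S -` A \<inter> X)) f"
proof -
  have "fa_entropy X m (\<lambda>x. f (S x)) = (\<Sum>v\<in>f ` X. eta (m {x \<in> X. f (S x) = v}))"
    using assms by (intro fa_entropy_superset) auto
  also have "\<dots> = (\<Sum>v\<in>f ` X. eta (m (S -` {x \<in> X. f x = v} \<inter> X)))"
  proof (rule sum.cong[OF refl])
    fix v
    have "{x \<in> X. f (S x) = v} = S -` {x \<in> X. f x = v} \<inter> X" using assms by auto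
    thus "eta (m {x \<in> X. f (S x) = v}) = eta (m (S -` {x \<in> X. f x = v} \<inter> X))" by simp
  qed
  finally show ?thesis by (simp add: fa_entropy_def)
qed

text \<open>Made to cover two cases: a probability measure on \<open>sets M\<close>, and a limit of
  averages on \<open>Pow X\<close>, of which finite additivity is all that is known.\<close>

locale fa_prob = algebra X \<A> for X :: "'a set" and \<A> :: "'a set set" +
  fixes m :: "'a set \<Rightarrow> real"
  assumes m_nonneg: "A \<in> \<A> \<Longrightarrow> m A \<ge> 0"
    and m_space: "m X = 1"
    and m_add: "A \<in> \<A> \<Longrightarrow> B \<in> \<A> \<Longrightarrow> A \<inter> B = {} \<Longrightarrow> m (A \<union> B) = m A + m B"
begin

abbreviation "ent f \<equiv> fa_entropy X m f"

definition simple :: "('a \<Rightarrow> 'b) \<Rightarrow> bool" where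
  "simple f \<longleftrightarrow> finite (f ` X) \<and> (\<forall>v. {x \<in> X. f x = v} \<in> \<A>)"

lemma simple_finite: "simple f \<Longrightarrow> finite (f ` X)"
  and simple_sets: "simple f \<Longrightarrow> {x \<in> X. f x = v} \<in> \<A>"
  by (auto simp: simple_def)

lemma m_empty [simp]: "m {} = 0"
  using m_add[of "{}" "{}"] by simp

lemma m_mono:
  assumes "A \<in> \<A>" "B \<in> \<A>" "A \<subseteq> B" shows "m A \<le> m B"
proof -
  have "A \<union> (B - A) = B" using assms by auto
  thus ?thesis using m_add[of A "B - A"] m_nonneg[of "B - A"] assms Diff[of B A] by auto
qed

lemma m_le_1: "A \<in> \<A> \<Longrightarrow> m A \<le> 1"
  using m_mono[of A X] m_space sets_into_space by auto

lemma m_Un_le: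
  assumes "A \<in> \<A>" "B \<in> \<A>" shows "m (A \<union> B) \<le> m A + m B"
proof -
  have "A \<union> B = A \<union> (B - A)" by auto
  hence "m (A \<union> B) = m A + m (B - A)" using m_add[of A "B - A"] assms Diff[of B A] by auto
  thus ?thesis using m_mono[of "B - A" B] assms Diff[of B A] by auto
qed

lemma m_UN_le:
  assumes "finite I" "\<And>i. i \<in> I \<Longrightarrow> A i \<in> \<A>"
  shows "m (\<Union>i\<in>I. A i) \<le> (\<Sum>i\<in>I. m (A i))"
  using assms
proof (induction I rule: finite_induct)
  case (insert i I)
  thus ?case using m_Un_le[of "A i" "\<Union>i\<in>I. A i"] by fastforce
qed simp

lemma m_compl: "A \<in> \<A> \<Longrightarrow> m (X - A) = 1 - m A"
  using m_add[of A "X - A"] m_space sets_into_space[of A] compl_sets[of A] by (simp add: Un_absorb1)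

lemma sum_m_fibres:
  assumes f: "simple f" and B: "B \<in> \<A>" and U: "finite U"
  shows "(\<Sum>u\<in>U. m {x \<in> B. f x = u}) = m {x \<in> B. f x \<in> U}"
  using U
proof (induction U rule: finite_induct)
  case (insert u U)
  have in_alg: "{x \<in> B. f x = u} \<in> \<A>" for u
  proof -
    have "{x \<in> B. f x = u} = B \<inter> {x \<in> X. f x = u}" using sets_into_space[OF B] by auto
    thus ?thesis using B simple_sets[OF f] by auto
  qed
  have "{x \<in> B. f x \<in> U} = (\<Union>u\<in>U. {x \<in> B. f x = u})" by auto
  hence "{x \<in> B. f x \<in> U} \<in> \<A>" using in_alg insert.hyps by auto
  moreover have "{x \<in> B. f x \<in> insert u U} = {x \<in> B. f x = u} \<union> {x \<in> B. f x \<in> U}" by auto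
  ultimately show ?case using insert in_alg[of u]
    by (subst \<open>{x \<in> B. f x \<in> insert u U} = _\<close>, subst m_add) auto
qed simp

lemma sum_m_fibres':
  assumes "simple f" "B \<in> \<A>"
  shows "(\<Sum>u\<in>f ` X. m {x \<in> B. f x = u}) = m B"
proof -
  have "{x \<in> B. f x \<in> f ` X} = B" using sets_into_space[OF assms(2)] by auto
  thus ?thesis using sum_m_fibres[OF assms simple_finite[OF assms(1)]] by simp
qed

lemma simple_coarser:
  assumes f: "simple f" and g: "\<And>x y. x \<in> X \<Longrightarrow> y \<in> X \<Longrightarrow> f x = f y \<Longrightarrow> g x = g y"
  shows "simple g"
  unfolding simple_def
proof (intro conjI allI)
  have "\<exists>\<phi>. \<forall>x\<in>X. g x = \<phi> (f x)"
    using g by (intro exI[of _ "\<lambda>v. g (SOME x. x \<in> X \<and> f x = v)"]) (metis (mono_tags, lifting) someI_ex)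
  then obtain \<phi> where \<phi>: "\<And>x. x \<in> X \<Longrightarrow> g x = \<phi> (f x)" by blast
  hence "g ` X = \<phi> ` f ` X" by (auto simp: image_iff)
  thus "finite (g ` X)" using simple_finite[OF f] by simp
  fix v
  have "{x \<in> X. g x = v} = (\<Union>u\<in>{u \<in> f ` X. \<phi> u = v}. {x \<in> X. f x = u})" using \<phi> by auto
  also have "\<dots> \<in> \<A>" using simple_finite[OF f] simple_sets[OF f] by (intro finite_UN) auto
  finally show "{x \<in> X. g x = v} \<in> \<A>" .
qed

lemma simple_pair:
  assumes "simple f" "simple g" shows "simple (\<lambda>x. (f x, g x))"
  unfolding simple_def
proof (intro conjI allI)
  have "(\<lambda>x. (f x, g x)) ` X \<subseteq> f ` X \<times> g ` X" by auto
  thus "finite ((\<lambda>x. (f x, g x)) ` X)"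
    using simple_finite[OF assms(1)] simple_finite[OF assms(2)] by (meson finite_SigmaI finite_subset)
  fix v
  have "{x \<in> X. (f x, g x) = v} = {x \<in> X. f x = fst v} \<inter> {x \<in> X. g x = snd v}"
    by (cases v) auto
  thus "{x \<in> X. (f x, g x) = v} \<in> \<A>"
    using Int[OF simple_sets[OF assms(1)] simple_sets[OF assms(2)]] by simp
qed

lemma simple_const: "simple (\<lambda>_. c)"
  unfolding simple_def
proof (intro conjI allI)
  show "{x \<in> X. c = v} \<in> \<A>" for v by (cases "c = v") auto
qed (rule finite_subset[of _ "{c}"], auto)

lemma ent_pair:
  assumes "simple f" "simple g"
  shows "ent (\<lambda>x. (f x, g x)) = (\<Sum>u\<in>f ` X. \<Sum>v\<in>g ` X. eta (m {x \<in> X. f x = u \<and> g x = v}))"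
proof -
  have "ent (\<lambda>x. (f x, g x)) = (\<Sum>z\<in>f ` X \<times> g ` X. eta (m {x \<in> X. (f x, g x) = z}))"
    using simple_finite[OF assms(1)] simple_finite[OF assms(2)] by (intro fa_entropy_superset) auto
  also have "\<dots> = (\<Sum>(u, v)\<in>f ` X \<times> g ` X. eta (m {x \<in> X. f x = u \<and> g x = v}))"
    by (intro sum.cong) auto
  finally show ?thesis by (simp only: sum.cartesian_product)
qed

lemma ent_triple:
  assumes "simple f" "simple g" "simple h"
  shows "ent (\<lambda>x. (f x, g x, h x)) =
    (\<Sum>u\<in>f ` X. \<Sum>v\<in>g ` X. \<Sum>w\<in>h ` X. eta (m {x \<in> X. f x = u \<and> g x = v \<and> h x = w}))"
proof -
  have "ent (\<lambda>x. (f x, g x, h x))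
      = (\<Sum>z\<in>f ` X \<times> g ` X \<times> h ` X. eta (m {x \<in> X. (f x, g x, h x) = z}))"
    using simple_finite[OF assms(1)] simple_finite[OF assms(2)] simple_finite[OF assms(3)]
    by (intro fa_entropy_superset) auto
  also have "\<dots> = (\<Sum>(u, v, w)\<in>f ` X \<times> g ` X \<times> h ` X. eta (m {x \<in> X. f x = u \<and> g x = v \<and> h x = w}))"
    by (intro sum.cong) auto
  finally show ?thesis by (simp only: sum.cartesian_product)
qed

text \<open>The function \<open>h\<close> plays the role of the common part: later \<open>f\<close>,
  \<open>g\<close>, \<open>h\<close> are the names on \<open>I - J\<close>, \<open>J - I\<close> and
  \<open>I \<inter> J\<close>.\<close>

lemma ent_submodular:
  assumes f: "simple f" and g: "simple g" and h: "simple h"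
  shows "ent (\<lambda>x. (f x, g x, h x)) + ent h \<le> ent (\<lambda>x. (f x, h x)) + ent (\<lambda>x. (g x, h x))"
proof -
  define p where "p u v w = m {x \<in> X. f x = u \<and> g x = v \<and> h x = w}" for u v w
  have alg: "{x \<in> X. f x = u \<and> h x = w} \<in> \<A>" "{x \<in> X. g x = v \<and> h x = w} \<in> \<A>"
    "{x \<in> X. f x = u \<and> g x = v \<and> h x = w} \<in> \<A>" for u v w
    using simple_sets[OF simple_pair[OF f h], of "(u, w)"] simple_sets[OF simple_pair[OF g h], of "(v, w)"]
      simple_sets[OF simple_pair[OF f simple_pair[OF g h]], of "(u, v, w)"] by auto
  have a: "(\<Sum>v\<in>g ` X. p u v w) = m {x \<in> X. f x = u \<and> h x = w}" for u w
    using sum_m_fibres'[OF g alg(1)[of u w]] by (simp add: p_def conj_ac cong: rev_conj_cong)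
  have b: "(\<Sum>u\<in>f ` X. p u v w) = m {x \<in> X. g x = v \<and> h x = w}" for v w
    using sum_m_fibres'[OF f alg(2)[of v w]] by (simp add: p_def conj_ac)
  have c: "(\<Sum>u\<in>f ` X. \<Sum>v\<in>g ` X. p u v w) = m {x \<in> X. h x = w}" for w
    using sum_m_fibres'[OF f simple_sets[OF h, of w]] by (simp add: a conj_ac)
  have "(\<Sum>u\<in>f ` X. \<Sum>v\<in>g ` X. \<Sum>w\<in>h ` X. eta (p u v w)) + (\<Sum>w\<in>h ` X. eta (\<Sum>u\<in>f ` X. \<Sum>v\<in>g ` X. p u v w))
    \<le> (\<Sum>u\<in>f ` X. \<Sum>w\<in>h ` X. eta (\<Sum>v\<in>g ` X. p u v w)) + (\<Sum>v\<in>g ` X. \<Sum>w\<in>h ` X. eta (\<Sum>u\<in>f ` X. p u v w))"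
    using assms alg m_nonneg by (intro sum_eta_submodular simple_finite) (auto simp: p_def)
  thus ?thesis unfolding c unfolding a b
      ent_triple[OF f g h] ent_pair[OF f h] ent_pair[OF g h]
    by (simp add: p_def fa_entropy_def)
qed

lemma ent_mono:
  assumes f: "simple f" and g: "\<And>x y. x \<in> X \<Longrightarrow> y \<in> X \<Longrightarrow> f x = f y \<Longrightarrow> g x = g y"
  shows "ent g \<le> ent f"
proof -
  have sg: "simple g" using simple_coarser f g by blast
  have alg: "{x \<in> X. f x = u \<and> g x = v} \<in> \<A>" for u v
    using simple_sets[OF simple_pair[OF f sg], of "(u, v)"] by simp
  have col: "(\<Sum>u\<in>f ` X. m {x \<in> X. f x = u \<and> g x = v}) = m {x \<in> X. g x = v}" for v
    using sum_m_fibres'[OF f simple_sets[OF sg, of v]] by (simp add: conj_ac)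
  have "eta (m {x \<in> X. g x = v}) \<le> (\<Sum>u\<in>f ` X. eta (m {x \<in> X. f x = u \<and> g x = v}))" for v
  proof -
    have "eta (m {x \<in> X. g x = v}) = (\<Sum>u\<in>f ` X. - (m {x \<in> X. f x = u \<and> g x = v} * ln (m {x \<in> X. g x = v})))"
      by (simp add: eta_def sum_negf sum_distrib_right [symmetric] col)
    also have "\<dots> \<le> (\<Sum>u\<in>f ` X. eta (m {x \<in> X. f x = u \<and> g x = v}))"
    proof (rule sum_mono)
      fix u
      let ?a = "m {x \<in> X. f x = u \<and> g x = v}" and ?b = "m {x \<in> X. g x = v}"
      have "0 \<le> ?a" using alg m_nonneg by blast
      moreover have "?a \<le> ?b" using alg simple_sets[OF sg] by (intro m_mono) auto
      ultimately show "- (?a * ln ?b) \<le> eta ?a"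
        by (cases "?a = 0") (auto simp: eta_def intro!: mult_left_mono)
    qed
    finally show ?thesis .
  qed
  hence "ent g \<le> (\<Sum>v\<in>g ` X. \<Sum>u\<in>f ` X. eta (m {x \<in> X. f x = u \<and> g x = v}))"
    unfolding fa_entropy_def by (intro sum_mono)
  also have "\<dots> = ent (\<lambda>x. (f x, g x))" unfolding ent_pair[OF f sg] by (rule sum.swap)
  also have "\<dots> = ent f" by (rule fa_entropy_kernel) (metis g prod.inject)
  finally show ?thesis .
qed

lemma ent_const [simp]: "ent (\<lambda>_. c) = 0"
  using m_space by (cases "X = {}") (auto simp: fa_entropy_def image_constant_conv)

lemma ent_subadditive:
  assumes "simple f" "simple g"
  shows "ent (\<lambda>x. (f x, g x)) \<le> ent f + ent g"
proof -
  have "ent (\<lambda>x. (f x, g x, ())) + ent (\<lambda>_. ()) \<le> ent (\<lambda>x. (f x, ())) + ent (\<lambda>x. (g x, ()))"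
    using assms simple_const by (rule ent_submodular)
  moreover have "ent (\<lambda>x. (f x, g x, ())) = ent (\<lambda>x. (f x, g x))"
    "ent (\<lambda>x. (f x, ())) = ent f" "ent (\<lambda>x. (g x, ())) = ent g"
    by (auto intro!: fa_entropy_kernel)
  ultimately show ?thesis by simp
qed

text \<open>The dominant cell contributes at most \<open>e\<close>, by
  \<open>eta p \<le> 1 - p\<close>. Every other cell has mass at most \<open>e\<close> and
  contributes at most \<open>2 * sqrt e\<close>.\<close>

lemma ent_nearly_constant:
  assumes b: "simple b" and e: "m {x \<in> X. b x = v0} \<ge> 1 - e"
  shows "ent b \<le> e + 2 * card (b ` X) * sqrt e"
proof -
  have e0: "e \<ge> 0" using e m_le_1[OF simple_sets[OF b, of v0]] by linarith
  have "ent b \<le> (\<Sum>v\<in>b ` X. (if v = v0 then e else 0) + 2 * sqrt e)"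
    unfolding fa_entropy_def
  proof (rule sum_mono)
    fix v
    let ?p = "m {x \<in> X. b x = v}"
    have p0: "?p \<ge> 0" using simple_sets[OF b] m_nonneg by blast
    show "eta ?p \<le> (if v = v0 then e else 0) + 2 * sqrt e"
    proof (cases "v = v0")
      case True
      have "eta ?p \<le> e" using eta_le_compl[OF p0] e True by simp
      thus ?thesis unfolding if_P[OF True] using real_sqrt_ge_zero[OF e0] by linarith
    next
      case False
      have "?p \<le> m (X - {x \<in> X. b x = v0})"
        using simple_sets[OF b] False by (intro m_mono) auto
      also have "\<dots> \<le> e" using e m_compl[OF simple_sets[OF b, of v0]] by simp
      finally have "sqrt ?p \<le> sqrt e" by (rule real_sqrt_le_mono)
      thus ?thesis unfolding if_not_P[OF False] using eta_le_sqrt[OF p0] by linarith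
    qed
  qed
  also have "\<dots> \<le> e + 2 * card (b ` X) * sqrt e"
    using e0 simple_finite[OF b] by (simp add: sum.distrib sum.delta')
  finally show ?thesis .
qed

text \<open>A form of Fano's inequality. The correction \<open>b\<close> reveals \<open>f\<close> on
  the bad set \<open>B\<close> and is \<open>None\<close> elsewhere, so \<open>(b, g)\<close>
  determines \<open>f\<close>, while \<open>b\<close> is nearly constant. The value
  \<open>None\<close> accounts for the \<open>+ 1\<close>.\<close>

lemma ent_nearly_determined:
  assumes f: "simple f" and g: "simple g" and B: "B \<in> \<A>" and e: "m B \<le> e"
    and det: "\<And>x y. x \<in> X - B \<Longrightarrow> y \<in> X - B \<Longrightarrow> g x = g y \<Longrightarrow> f x = f y"
  shows "ent (\<lambda>x. (f x, g x)) \<le> ent g + (e + 2 * (card (f ` X) + 1) * sqrt e)"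
proof -
  define b where "b x = (if x \<in> B then Some (f x) else None)" for x
  have e0: "e \<ge> 0" using m_nonneg[OF B] e by simp
  have none: "{x \<in> X. b x = None} = X - B" by (auto simp: b_def)
  have im: "b ` X \<subseteq> insert None (Some ` f ` X)" by (auto simp: b_def)
  have sb: "simple b" unfolding simple_def
  proof (intro conjI allI)
    show "finite (b ` X)" using im simple_finite[OF f] finite_subset by blast
    fix v
    show "{x \<in> X. b x = v} \<in> \<A>"
    proof (cases v)
      case None
      thus ?thesis using none B by auto
    next
      case (Some u)
      hence "{x \<in> X. b x = v} = {x \<in> X. f x = u} \<inter> B" by (auto simp: b_def)
      thus ?thesis using B simple_sets[OF f] by auto
    qed
  qed
  have "card (b ` X) \<le> card (insert None (Some ` f ` X))"
    using im simple_finite[OF f] by (intro card_mono) auto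
  also have "\<dots> \<le> card (f ` X) + 1"
    using simple_finite[OF f] by (simp add: card_insert_if card_image)
  finally have card: "card (b ` X) \<le> card (f ` X) + 1" .
  have "ent (\<lambda>x. (f x, g x)) \<le> ent (\<lambda>x. (b x, g x))"
  proof (rule ent_mono[OF simple_pair[OF sb g]])
    fix x y assume "x \<in> X" "y \<in> X" "(b x, g x) = (b y, g y)"
    thus "(f x, g x) = (f y, g y)"
      using det[of x y] by (auto simp: b_def split: if_splits)
  qed
  also have "\<dots> \<le> ent b + ent g" by (rule ent_subadditive[OF sb g])
  also have "ent b \<le> e + 2 * card (b ` X) * sqrt e"
    using ent_nearly_constant[OF sb, of e None] none m_compl[OF B] e by simp
  also have "\<dots> \<le> e + 2 * (card (f ` X) + 1) * sqrt e"
    using card e0 by (intro add_left_mono mult_right_mono) auto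
  finally show ?thesis by simp
qed

lemma ent_le_card:
  assumes "simple f"
  shows "ent f \<le> card (f ` X)"
proof -
  have "ent f \<le> (\<Sum>v\<in>f ` X. 1)" unfolding fa_entropy_def
  proof (rule sum_mono)
    fix v
    have "m {x \<in> X. f x = v} \<ge> 0" using simple_sets[OF assms] m_nonneg by blast
    thus "eta (m {x \<in> X. f x = v}) \<le> 1" using eta_le_compl by force
  qed
  thus ?thesis by simp
qed

end

section \<open>Names of points along sets of coordinates\<close>

definition name :: "('a \<Rightarrow> 'a) \<Rightarrow> (nat \<Rightarrow> 'a \<Rightarrow> nat) \<Rightarrow> (nat \<times> nat) set \<Rightarrow> 'a \<Rightarrow> nat \<times> nat \<Rightarrow> nat" where
  "name T \<alpha> I x = restrict (\<lambda>(k, n). \<alpha> k ((T ^^ n) x)) I"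

text \<open>Outside \<open>I\<close> all names are \<open>undefined\<close>, thanks to
  \<open>restrict\<close>. Equality of names is therefore agreement on \<open>I\<close>, and
  inclusions of coordinate sets turn into implications between such equalities.\<close>

lemma name_eq_iff: "name T \<alpha> I x = name T \<alpha> I y \<longleftrightarrow> (\<forall>k n. (k, n) \<in> I \<longrightarrow> \<alpha> k ((T ^^ n) x) = \<alpha> k ((T ^^ n) y))"
  by (auto simp: name_def restrict_def fun_eq_iff split: prod.splits)

lemma funpow_image_subset: "T ` X \<subseteq> X \<Longrightarrow> x \<in> X \<Longrightarrow> (T ^^ n) x \<in> X"
  by (induction n) auto

text \<open>Invariance is left to a later extension, because the uniform distributions on separated
  sets, to which the block estimate \<open>average_entropy_ge\<close> is applied, are not
  invariant.\<close>

locale fa_coded_map = fa_prob X \<A> m for X :: "'a set" and \<A> and m +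
  fixes T :: "'a \<Rightarrow> 'a" and \<alpha> :: "nat \<Rightarrow> 'a \<Rightarrow> nat"
  assumes T_in: "T ` X \<subseteq> X"
    and T_sets: "A \<in> \<A> \<Longrightarrow> T -` A \<inter> X \<in> \<A>"
    and simple_\<alpha>: "simple (\<alpha> k)"
begin

lemma T_pow_in: "x \<in> X \<Longrightarrow> (T ^^ n) x \<in> X"
  using T_in by (rule funpow_image_subset)

lemma T_pow_vimage_Suc: "(T ^^ Suc n) -` A \<inter> X = T -` ((T ^^ n) -` A \<inter> X) \<inter> X"
  using T_in by (auto simp: funpow_swap1)

lemma T_pow_sets: "A \<in> \<A> \<Longrightarrow> (T ^^ n) -` A \<inter> X \<in> \<A>"
proof (induction n)
  case 0
  thus ?case using sets_into_space[of A] by (simp add: Int_absorb2)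
next
  case (Suc n)
  thus ?case using T_sets T_pow_vimage_Suc by metis
qed

lemma simple_comp_T_pow:
  assumes "simple f" shows "simple (\<lambda>x. f ((T ^^ n) x))"
  unfolding simple_def
proof (intro conjI allI)
  have "(\<lambda>x. f ((T ^^ n) x)) ` X \<subseteq> f ` X" using T_pow_in by auto
  thus "finite ((\<lambda>x. f ((T ^^ n) x)) ` X)" using simple_finite[OF assms] finite_subset by blast
  fix v
  have "{x \<in> X. f ((T ^^ n) x) = v} = (T ^^ n) -` {x \<in> X. f x = v} \<inter> X" using T_pow_in by auto
  thus "{x \<in> X. f ((T ^^ n) x) = v} \<in> \<A>" using T_pow_sets simple_sets[OF assms] by metis
qed

lemma simple_name: "finite I \<Longrightarrow> simple (name T \<alpha> I)"
proof (induction I rule: finite_induct)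
  case empty
  show ?case by (rule simple_coarser[OF simple_const[of "()"]]) (simp add: name_eq_iff)
next
  case (insert i I)
  obtain k n where i: "i = (k, n)" by (cases i)
  have "simple (\<lambda>x. (\<alpha> k ((T ^^ n) x), name T \<alpha> I x))"
    using insert simple_\<alpha> by (intro simple_pair simple_comp_T_pow) auto
  thus ?case by (rule simple_coarser) (auto simp: name_eq_iff i)
qed

lemma ent_name_mono: "finite J \<Longrightarrow> I \<subseteq> J \<Longrightarrow> ent (name T \<alpha> I) \<le> ent (name T \<alpha> J)"
  by (rule ent_mono[OF simple_name]) (auto simp: name_eq_iff)

lemma ent_name_submodular:
  assumes "finite I" "finite J"
  shows "ent (name T \<alpha> (I \<union> J)) + ent (name T \<alpha> (I \<inter> J)) \<le> ent (name T \<alpha> I) + ent (name T \<alpha> J)"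
proof -
  let ?f = "name T \<alpha> (I - J)" and ?g = "name T \<alpha> (J - I)" and ?h = "name T \<alpha> (I \<inter> J)"
  have "ent (\<lambda>x. (?f x, ?g x, ?h x)) + ent ?h \<le> ent (\<lambda>x. (?f x, ?h x)) + ent (\<lambda>x. (?g x, ?h x))"
    using assms by (intro ent_submodular simple_name) auto
  moreover have "ent (\<lambda>x. (?f x, ?g x, ?h x)) = ent (name T \<alpha> (I \<union> J))"
    by (rule fa_entropy_kernel) (unfold name_eq_iff prod.inject Un_iff Int_iff Diff_iff, blast)
  moreover have "ent (\<lambda>x. (?f x, ?h x)) = ent (name T \<alpha> I)"
    by (rule fa_entropy_kernel) (auto simp: name_eq_iff)
  moreover have "ent (\<lambda>x. (?g x, ?h x)) = ent (name T \<alpha> J)"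
    by (rule fa_entropy_kernel) (auto simp: name_eq_iff)
  ultimately show ?thesis by simp
qed

lemma ent_name_tshift_pow:
  assumes "finite I"
  shows "ent (name T \<alpha> (tshift i I)) = fa_entropy X (\<lambda>A. m ((T ^^ i) -` A \<inter> X)) (name T \<alpha> I)"
proof -
  have "ent (name T \<alpha> (tshift i I)) = ent (\<lambda>x. name T \<alpha> I ((T ^^ i) x))"
  proof (rule fa_entropy_kernel)
    have "(T ^^ n) ((T ^^ i) x) = (T ^^ (n + i)) x" for n x by (simp add: funpow_add)
    thus "name T \<alpha> (tshift i I) x = name T \<alpha> (tshift i I) y
        \<longleftrightarrow> name T \<alpha> I ((T ^^ i) x) = name T \<alpha> I ((T ^^ i) y)" for x y
      unfolding name_eq_iff mem_tshift by metis
  qed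
  also have "\<dots> = fa_entropy X (\<lambda>A. m ((T ^^ i) -` A \<inter> X)) (name T \<alpha> I)"
    using simple_finite[OF simple_name[OF assms]] T_pow_in by (intro fa_entropy_comp) auto
  finally show ?thesis .
qed

end

locale fa_coded_system = fa_coded_map +
  assumes m_inv: "A \<in> \<A> \<Longrightarrow> m (T -` A \<inter> X) = m A"
begin

lemma m_inv_pow: "A \<in> \<A> \<Longrightarrow> m ((T ^^ n) -` A \<inter> X) = m A"
proof (induction n)
  case 0
  thus ?case using sets_into_space[of A] by (simp add: Int_absorb2)
next
  case (Suc n)
  thus ?case using m_inv T_pow_sets T_pow_vimage_Suc by metis
qed

lemma ent_name_tshift:
  assumes "finite I"
  shows "ent (name T \<alpha> (tshift 1 I)) = ent (name T \<alpha> I)"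
proof -
  have "fa_entropy X (\<lambda>A. m ((T ^^ 1) -` A \<inter> X)) (name T \<alpha> I) = ent (name T \<alpha> I)"
    unfolding fa_entropy_def
    by (intro sum.cong refl arg_cong[of _ _ eta] m_inv_pow simple_sets[OF simple_name[OF assms]])
  thus ?thesis unfolding ent_name_tshift_pow[OF assms] .
qed

sublocale shift_submodular "\<lambda>I. ent (name T \<alpha> I)"
proof
  show "ent (name T \<alpha> {}) = 0"
    using fa_entropy_kernel[of X "name T \<alpha> {}" "\<lambda>_. ()" m] by (simp add: name_eq_iff)
qed (rule ent_name_mono ent_name_submodular ent_name_tshift; assumption)+

end

section \<open>Compact systems\<close>

lemma eventually_continuous_nat_eq:
  fixes f :: "'a::metric_space \<Rightarrow> nat"
  assumes "continuous_on W f" "x \<in> W" "xs \<longlonglongrightarrow> x" "eventually (\<lambda>n. xs n \<in> W) sequentially"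
  shows "eventually (\<lambda>n. f (xs n) = f x) sequentially"
  using continuous_on_tendsto_compose[OF assms(1,3,2,4)] by (simp add: tendsto_discrete)

text \<open>The constant pieces on finitely many closed fibres are glued together.\<close>

lemma continuous_on_closed_fibres:
  fixes f :: "'a::metric_space \<Rightarrow> 'b::topological_space"
  assumes "finite (f ` W)" "\<And>v. closed {x \<in> W. f x = v}"
  shows "continuous_on W f"
proof -
  have "continuous_on (\<Union>v\<in>f ` W. {x \<in> W. f x = v}) f"
  proof (rule continuous_on_closed_Union)
    fix v
    have "continuous_on {x \<in> W. f x = v} (\<lambda>_. v)" by simp
    thus "continuous_on {x \<in> W. f x = v} f" by (rule continuous_on_eq) auto
  qed (use assms in auto)
  moreover have "(\<Union>v\<in>f ` W. {x \<in> W. f x = v}) = W" by auto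
  ultimately show ?thesis by simp
qed

locale fa_compact = fa_prob X \<A> m for X :: "'a::metric_space set" and \<A> and m +
  assumes compact_X: "compact X"
    and compact_sets: "compact C \<Longrightarrow> C \<subseteq> X \<Longrightarrow> C \<in> \<A>"
begin

text \<open>The conclusion of Lusin's theorem, taken as a requirement since finite additivity does
  not yield it. For a function into \<open>nat\<close>, continuity on \<open>W\<close> means that
  the cells are relatively clopen there.\<close>

definition nearly_continuous :: "('a \<Rightarrow> 'b::topological_space) \<Rightarrow> bool" where
  "nearly_continuous f \<longleftrightarrow>
    (\<forall>e>0. \<exists>W. compact W \<and> W \<subseteq> X \<and> m (X - W) \<le> e \<and> continuous_on W f)"

lemma closed_sets: "closed C \<Longrightarrow> X \<inter> C \<in> \<A>"
  using compact_X by (intro compact_sets compact_Int_closed) auto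

lemma ball_sets: "X \<inter> ball x r \<in> \<A>"
proof -
  have "X \<inter> ball x r = X - X \<inter> - ball x r" by auto
  thus ?thesis using closed_sets[of "- ball x r"] compl_sets by (metis closed_Compl open_ball)
qed

text \<open>The mass of \<open>ball x r\<close> is monotone in \<open>r\<close>, so spheres around \<open>x\<close> have negligible
  neighbourhoods for all but countably many radii.\<close>
lemma exists_negligible_sphere:
  assumes "a < b"
  shows "\<exists>r. a < r \<and> r < b \<and>
    (\<forall>e>0. \<exists>h>0. m (X \<inter> ball x (r + h) - ball x (r - h)) \<le> e)"
proof -
  define g where "g s = m (X \<inter> ball x s)" for s
  have "mono g" unfolding g_def mono_def
    using ball_sets subset_ball by (intro allI impI m_mono) auto
  hence "countable {r. \<not> isCont g r}" by (rule mono_ctble_discont)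
  moreover have "uncountable {a<..<b}" using assms uncountable_open_interval by blast
  ultimately have "\<not> {a<..<b} \<subseteq> {r. \<not> isCont g r}" using countable_subset by blast
  then obtain r where r: "a < r" "r < b" "isCont g r" by auto
  have "\<exists>h>0. m (X \<inter> ball x (r + h) - ball x (r - h)) \<le> e" if e: "e > 0" for e
  proof -
    obtain d where d: "d > 0" "\<And>s. dist s r < d \<Longrightarrow> dist (g s) (g r) < e / 2"
      using r(3) e unfolding continuous_at_eps_delta by (metis half_gt_zero)
    define h where "h = d / 2"
    have h: "h > 0" using d by (simp add: h_def)
    have 1: "dist (g (r + h)) (g r) < e / 2" "dist (g (r - h)) (g r) < e / 2"
      using d by (auto simp: h_def dist_real_def)
    let ?S = "X \<inter> ball x (r + h) - ball x (r - h)"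
    have S: "?S = (X \<inter> ball x (r + h)) - (X \<inter> ball x (r - h))" by auto
    have "m ((X \<inter> ball x (r - h)) \<union> ?S) = g (r - h) + m ?S"
      unfolding S g_def by (rule m_add) (use ball_sets in auto)
    moreover have "(X \<inter> ball x (r - h)) \<union> ?S = X \<inter> ball x (r + h)" using h by auto
    ultimately have "g (r + h) = g (r - h) + m ?S" by (simp only: g_def)
    hence "m ?S \<le> e" using 1 unfolding dist_real_def by linarith
    thus ?thesis using h by blast
  qed
  thus ?thesis using r by blast
qed

text \<open>A point is coded by the first ball of a finite cover that contains it. The radii are
  below \<open>d / 2\<close> and the bounding spheres have negligible neighbourhoods; once thin
  shells are removed, every ball is clopen in what remains.\<close>

lemma exists_small_nearly_continuous:
  assumes d: "d > 0"
  shows "\<exists>f :: 'a \<Rightarrow> nat. simple f \<and> nearly_continuous f \<and>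
    (\<forall>x\<in>X. \<forall>y\<in>X. f x = f y \<longrightarrow> dist x y < d)"
proof -
  have "\<forall>x. \<exists>r. 0 < r \<and> r < d / 2 \<and> (\<forall>e>0. \<exists>h>0. m (X \<inter> ball x (r + h) - ball x (r - h)) \<le> e)"
    using exists_negligible_sphere[of 0 "d / 2"] d by auto
  then obtain r where r: "\<And>x. 0 < r x" "\<And>x. r x < d / 2"
    and r_negl: "\<And>x e. e > 0 \<Longrightarrow> \<exists>h>0. m (X \<inter> ball x (r x + h) - ball x (r x - h)) \<le> e"
    by metis
  have "X \<subseteq> (\<Union>x\<in>X. ball x (r x))" using r by auto
  then obtain F where F: "F \<subseteq> X" "finite F" "X \<subseteq> (\<Union>x\<in>F. ball x (r x))"
    using compactE_image[OF compact_X, of X "\<lambda>x. ball x (r x)"] by blast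
  obtain xs where xs: "set xs = F" using F finite_list by blast
  define n where "n = length xs"
  define B where "B i = ball (xs ! i) (r (xs ! i))" for i
  define f where "f y = (LEAST i. y \<in> B i)" for y
  have ex: "\<exists>i<n. y \<in> B i" if "y \<in> X" for y
    using F(3) that xs unfolding B_def n_def by (force simp: in_set_conv_nth)
  have f_in: "y \<in> B (f y)" "f y < n" if y: "y \<in> X" for y
  proof -
    obtain i where i: "i < n" "y \<in> B i" using ex[OF y] by blast
    show "y \<in> B (f y)" unfolding f_def using i by (rule_tac LeastI)
    have "f y \<le> i" unfolding f_def using i by (rule_tac Least_le)
    thus "f y < n" using i by simp
  qed
  have f_eq: "f y = i \<longleftrightarrow> y \<in> B i \<and> (\<forall>j<i. y \<notin> B j)" if y: "y \<in> X" for y i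
  proof
    assume "f y = i"
    moreover have "y \<notin> B j" if "j < f y" for j
      using that not_less_Least[of j "\<lambda>i. y \<in> B i"] unfolding f_def by blast
    ultimately show "y \<in> B i \<and> (\<forall>j<i. y \<notin> B j)" using f_in[OF y] by blast
  next
    assume "y \<in> B i \<and> (\<forall>j<i. y \<notin> B j)"
    thus "f y = i" unfolding f_def by (intro Least_equality) (meson leI)+
  qed
  have fim: "finite (f ` X)" by (rule finite_subset[of _ "{..<n}"]) (use f_in in auto)
  have "simple f" unfolding simple_def
  proof (intro conjI allI fim)
    fix i
    have "{y \<in> X. f y = i} = X \<inter> B i - (\<Union>j\<in>{..<i}. X \<inter> B j)" using f_eq by auto
    also have "\<dots> \<in> \<A>" using ball_sets unfolding B_def by (intro Diff finite_UN) auto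
    finally show "{y \<in> X. f y = i} \<in> \<A>" .
  qed
  moreover have "dist x y < d" if "x \<in> X" "y \<in> X" "f x = f y" for x y
  proof -
    have "x \<in> B (f x)" "y \<in> B (f x)" using f_in that by metis+
    hence "dist (xs ! f x) x < d / 2" "dist (xs ! f x) y < d / 2"
      using r(2)[of "xs ! f x"] unfolding B_def by auto
    thus ?thesis by (metis dist_commute dist_triangle_half_r)
  qed
  moreover have "nearly_continuous f" unfolding nearly_continuous_def
  proof (intro allI impI)
    fix e :: real assume e: "e > 0"
    \<comment> \<open>The share \<open>e / (n + 1)\<close> also makes sense for
      \<open>n = 0\<close>, that is, for empty \<open>X\<close>.\<close>
    have "\<forall>i. \<exists>h>0. m (X \<inter> ball (xs ! i) (r (xs ! i) + h) - ball (xs ! i) (r (xs ! i) - h)) \<le> e / (real n + 1)"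
      using r_negl e by simp
    then obtain h where h: "\<And>i. h i > 0"
      and hm: "\<And>i. m (X \<inter> ball (xs ! i) (r (xs ! i) + h i) - ball (xs ! i) (r (xs ! i) - h i)) \<le> e / (real n + 1)"
      by metis
    \<comment> \<open>A closed core inside the ball and a closed set outside it; between them lies
      the removed shell.\<close>
    define I where "I i = cball (xs ! i) (r (xs ! i) - h i)" for i
    define O' where "O' i = - ball (xs ! i) (r (xs ! i) + h i)" for i
    define W where "W = X \<inter> (\<Inter>i<n. I i \<union> O' i)"
    have clI: "closed (I i)" and clO: "closed (O' i)" for i by (auto simp: I_def O'_def)
    have IB: "I i \<subseteq> B i" and OB: "O' i \<inter> B i = {}" for i
      using h[of i] by (auto simp: I_def O'_def B_def)
    have clW: "closed (\<Inter>i<n. I i \<union> O' i)" using clI clO by auto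
    have WX: "W \<subseteq> X" by (simp add: W_def)
    have W: "compact W" unfolding W_def using compact_X clW by (rule compact_Int_closed)
    moreover have "m (X - W) \<le> e"
    proof -
      let ?S = "\<lambda>i. X \<inter> ball (xs ! i) (r (xs ! i) + h i) - ball (xs ! i) (r (xs ! i) - h i)"
      have S: "?S i \<in> \<A>" for i
      proof -
        have "?S i = (X \<inter> ball (xs ! i) (r (xs ! i) + h i)) - (X \<inter> ball (xs ! i) (r (xs ! i) - h i))" by auto
        thus ?thesis using ball_sets Diff by metis
      qed
      have "X - W \<subseteq> (\<Union>i<n. ?S i)" by (auto simp: W_def I_def O'_def)
      hence "m (X - W) \<le> m (\<Union>i<n. ?S i)"
        using S compact_sets[OF W WX] by (intro m_mono) auto
      also have "\<dots> \<le> (\<Sum>i<n. m (?S i))" using S by (intro m_UN_le) auto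
      also have "\<dots> \<le> (\<Sum>i<n. e / (real n + 1))" using hm by (intro sum_mono)
      also have "\<dots> \<le> e" using e by (simp add: field_simps)
      finally show ?thesis .
    qed
    moreover have "continuous_on W f"
    proof (rule continuous_on_closed_fibres)
      show "finite (f ` W)" by (rule finite_subset[OF image_mono[OF WX] fim])
      fix i
      show "closed {x \<in> W. f x = i}"
      proof (cases "i < n")
        case True
        have "{x \<in> W. f x = i} = W \<inter> (I i \<inter> (\<Inter>j<i. O' j))"
        proof (intro set_eqI iffI)
          fix x assume "x \<in> {x \<in> W. f x = i}"
          hence x: "x \<in> W" "x \<in> X" "f x = i" using WX by auto
          hence "x \<in> B i" "\<forall>j<i. x \<notin> B j" using f_eq by auto
          moreover have "x \<in> I j \<union> O' j" if "j < n" for j using x that by (auto simp: W_def)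
          ultimately have "x \<in> I i" "\<And>j. j < i \<Longrightarrow> x \<in> O' j"
            using True IB OB by (blast, meson Un_iff less_trans subsetD)
          thus "x \<in> W \<inter> (I i \<inter> (\<Inter>j<i. O' j))" using x by blast
        next
          fix x assume "x \<in> W \<inter> (I i \<inter> (\<Inter>j<i. O' j))"
          hence x: "x \<in> W" "x \<in> I i" "\<And>j. j < i \<Longrightarrow> x \<in> O' j" by auto
          have "x \<in> B i" "\<And>j. j < i \<Longrightarrow> x \<notin> B j" using x IB OB by blast+
          thus "x \<in> {x \<in> W. f x = i}" using f_eq[of x i] x(1) WX by blast
        qed
        moreover have "closed \<dots>"
          using compact_imp_closed[OF W] clI clO by (intro closed_Int closed_INT) auto
        ultimately show ?thesis by simp
      next
        case False
        hence "{x \<in> W. f x = i} = {}" using f_in WX by auto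
        thus ?thesis by (simp only: closed_empty)
      qed
    qed
    ultimately show "\<exists>W. compact W \<and> W \<subseteq> X \<and> m (X - W) \<le> e \<and> continuous_on W f"
      using WX by blast
  qed
  ultimately show ?thesis by blast
qed

end

section \<open>Asymptotic twins by compactness\<close>

locale fa_compact_system = fa_coded_system X \<A> m T \<alpha> + fa_compact X \<A> m
  for X :: "'a::metric_space set" and \<A> m T \<alpha> +
  assumes continuous_T: "continuous_on X T"
begin

lemma continuous_T_pow: "continuous_on X (T ^^ n)"
proof (induction n)
  case (Suc n)
  have "continuous_on ((T ^^ n) ` X) T"
    using continuous_T by (rule continuous_on_subset) (use T_pow_in in auto)
  hence "continuous_on X (T \<circ> (T ^^ n))" using Suc by (intro continuous_on_compose)
  thus ?case by simp
qed (simp add: id_def)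

lemma nearly_continuous_comp_T_pow:
  assumes "nearly_continuous f" shows "nearly_continuous (\<lambda>x. f ((T ^^ n) x))"
  unfolding nearly_continuous_def
proof (intro allI impI)
  fix e :: real assume "e > 0"
  then obtain W where W: "compact W" "W \<subseteq> X" "m (X - W) \<le> e" "continuous_on W f"
    using assms unfolding nearly_continuous_def by blast
  define V where "V = (T ^^ n) -` W \<inter> X"
  have "closedin (top_of_set X) (X \<inter> (T ^^ n) -` W)"
    using continuous_T_pow compact_imp_closed[OF W(1)] by (rule continuous_closedin_preimage)
  hence "compact V" using compact_X by (simp add: V_def Int_commute closedin_compact)
  moreover have "X - V = (T ^^ n) -` (X - W) \<inter> X" using T_pow_in by (auto simp: V_def)
  hence "m (X - V) \<le> e" using m_inv_pow[of "X - W" n] compl_sets[OF compact_sets[OF W(1,2)]] W(3) by simp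
  moreover have "continuous_on V (f \<circ> (T ^^ n))"
    using continuous_on_subset[OF continuous_T_pow, of V n] W(4)
    by (intro continuous_on_compose) (auto simp: V_def intro: continuous_on_subset)
  ultimately show "\<exists>W. compact W \<and> W \<subseteq> X \<and> m (X - W) \<le> e \<and> continuous_on W (\<lambda>x. f ((T ^^ n) x))"
    by (intro exI[of _ V]) (auto simp: V_def o_def)
qed

text \<open>Here \<open>F N\<close> lists the coordinates seen up to stage \<open>N\<close> of a future coding which forgets
  \<open>\<alpha> 0\<close> at time \<open>0\<close>. As \<open>\<alpha> 0\<close> has positive entropy given every \<open>F N\<close>, no \<open>F N\<close> nearly
  determines it; so the set \<open>Q N\<close> of points with an \<open>F N\<close>-twin on which \<open>\<alpha> 0\<close> differs stays
  large. By compactness and near continuity the twins survive in the limit.\<close>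
theorem exists_asymptotic_core:
  assumes pos: "rate {(0, 0)} > 0"
    and nc: "\<And>k. nearly_continuous (\<alpha> k)"
    and small: "\<And>k x y. x \<in> X \<Longrightarrow> y \<in> X \<Longrightarrow> \<alpha> (Suc k) x = \<alpha> (Suc k) y \<Longrightarrow> dist x y < 1 / Suc k"
  shows "\<exists>Q e. e > 0 \<and> decseq Q \<and> (\<forall>N. compact (Q N) \<and> Q N \<subseteq> X \<and> m (Q N) \<ge> e) \<and>
    (\<Inter>N. Q N) \<subseteq> {x. \<exists>y. (x, y) \<in> proper_asymptotic_pairs X T}"
proof -
  define c where "c = rate {(0, 0)} / 2"
  have c: "c > 0" using pos by (simp add: c_def)
  obtain s where s: "\<And>k L. cond {(0, 0)} (block ((\<lambda>j. (j, s j)) ` {..k}) 1 L) \<ge> c"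
    using exists_delays[OF pos] unfolding c_def by blast
  \<comment> \<open>Rows and times grow together. All these times are positive, so
    \<open>(0, 0)\<close> is never among them.\<close>
  define F where "F N = block ((\<lambda>j. (j, s j)) ` {..N}) 1 N" for N
  have finF [simp]: "finite (F N)" for N by (simp add: F_def)
  have F_mono: "F N \<subseteq> F N'" if "N \<le> N'" for N N'
    unfolding F_def using that by (intro block_mono image_mono) auto
  have F_mem: "(k, s k + t) \<in> F N" if "k \<le> N" "1 \<le> t" "t < N" for k t N
    unfolding F_def using that by (intro mem_block_singleton) auto
  \<comment> \<open>The error term of \<open>ent_nearly_determined\<close> for
    \<open>f = \<alpha> 0\<close>. The mass \<open>t0\<close> is chosen such that this error stays
    below the entropy \<open>c\<close> that every stage leaves.\<close>
  define \<phi> where "\<phi> t = t + 2 * (card (\<alpha> 0 ` X) + 1) * sqrt t" for t :: real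
  have "isCont \<phi> 0" unfolding \<phi>_def by (intro continuous_intros)
  moreover have "\<phi> 0 = 0" by (simp add: \<phi>_def)
  ultimately obtain d where d: "d > 0" "\<And>t. dist t 0 < d \<Longrightarrow> dist (\<phi> t) 0 < c"
    using c unfolding continuous_at_eps_delta by metis
  define t0 where "t0 = d / 2"
  have t0: "t0 > 0" "\<phi> t0 < c" using d(1) d(2)[of t0] by (auto simp: t0_def dist_real_def)

  \<comment> \<open>Numbering the coordinates by \<open>prod_encode\<close> makes the exceptional
    masses sum to at most \<open>t0 / 2\<close> over all coordinates, so the loss in
    \<open>K N\<close> is bounded uniformly in \<open>N\<close>.\<close>
  have "\<forall>i. \<exists>W. compact W \<and> W \<subseteq> X \<and> m (X - W) \<le> t0 / 2 * (1 / 2) ^ Suc (prod_encode i) \<and>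
    continuous_on W (\<lambda>x. \<alpha> (fst i) ((T ^^ snd i) x))"
  proof
    fix i
    have "t0 / 2 * (1 / 2) ^ Suc (prod_encode i) > 0" using t0(1) by simp
    thus "\<exists>W. compact W \<and> W \<subseteq> X \<and> m (X - W) \<le> t0 / 2 * (1 / 2) ^ Suc (prod_encode i) \<and>
        continuous_on W (\<lambda>x. \<alpha> (fst i) ((T ^^ snd i) x))"
      using nearly_continuous_comp_T_pow[OF nc, of "fst i" "snd i"] unfolding nearly_continuous_def by blast
  qed
  then obtain W where W: "\<And>i. compact (W i)" "\<And>i. W i \<subseteq> X"
    "\<And>i. m (X - W i) \<le> t0 / 2 * (1 / 2) ^ Suc (prod_encode i)"
    "\<And>i. continuous_on (W i) (\<lambda>x. \<alpha> (fst i) ((T ^^ snd i) x))"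
    by metis
  define K where "K N = (\<Inter>i\<in>insert (0, 0) (F N). W i)" for N
  have KW: "K N \<subseteq> W i" if "i \<in> insert (0, 0) (F N)" for N i using that by (auto simp: K_def)
  have KX: "K N \<subseteq> X" for N using KW[of "(0, 0)" N] W(2) by blast
  have clK: "closed (K N)" for N
    unfolding K_def using W(1) compact_imp_closed by (intro closed_INT) blast
  have cK: "compact (K N)" for N
    using compact_Int_closed[OF compact_X clK[of N]] KX[of N] by (simp add: Int_absorb1)
  have K_mono: "K N' \<subseteq> K N" if "N \<le> N'" for N N'
    unfolding K_def using F_mono[OF that] by (intro INF_superset_mono) auto
  have mK: "m (X - K N) \<le> t0 / 2" for N
  proof -
    let ?I = "insert (0, 0) (F N)"
    have XW: "X - W i \<in> \<A>" for i using compl_sets[OF compact_sets[OF W(1,2)]] .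
    have "X - K N = (\<Union>i\<in>?I. X - W i)" by (auto simp: K_def)
    hence "m (X - K N) \<le> (\<Sum>i\<in>?I. m (X - W i))" using XW by (simp only:) (intro m_UN_le, auto)
    also have "\<dots> \<le> (\<Sum>i\<in>?I. t0 / 2 * (1 / 2) ^ Suc (prod_encode i))" by (intro sum_mono W)
    also have "\<dots> = t0 / 2 * (\<Sum>n\<in>prod_encode ` ?I. (1 / 2) ^ Suc n)"
      by (subst sum.reindex) (auto intro: inj_prod_encode simp: sum_distrib_left)
    also have "(\<Sum>n\<in>prod_encode ` ?I. (1 / 2) ^ Suc n) \<le> (1 :: real)"
      using sum_le_suminf[OF sums_summable[OF power_half_series], of "prod_encode ` ?I"]
        sums_unique[OF power_half_series] by simp
    finally show ?thesis using t0 by simp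
  qed
  have ev: "eventually (\<lambda>n. name T \<alpha> (insert (0, 0) (F N)) (xs n) = name T \<alpha> (insert (0, 0) (F N)) x) sequentially"
    if "x \<in> K N" "xs \<longlonglongrightarrow> x" "eventually (\<lambda>n. xs n \<in> K N) sequentially" for xs x N
  proof -
    have "eventually (\<lambda>n. \<forall>i\<in>insert (0, 0) (F N).
        \<alpha> (fst i) ((T ^^ snd i) (xs n)) = \<alpha> (fst i) ((T ^^ snd i) x)) sequentially"
    proof (rule eventually_ball_finite, simp, rule ballI)
      fix i assume i: "i \<in> insert (0, 0) (F N)"
      have "eventually (\<lambda>n. xs n \<in> W i) sequentially"
        using that(3) by (rule eventually_mono) (use KW[OF i] in blast)
      thus "eventually (\<lambda>n. \<alpha> (fst i) ((T ^^ snd i) (xs n)) = \<alpha> (fst i) ((T ^^ snd i) x)) sequentially"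
        using eventually_continuous_nat_eq[OF W(4)] that KW[OF i] by blast
    qed
    thus ?thesis by (rule eventually_mono) (fastforce simp: name_eq_iff)
  qed
  have nm0: "\<alpha> 0 x = \<alpha> 0 y" "name T \<alpha> (F N) x = name T \<alpha> (F N) y"
    if "name T \<alpha> (insert (0, 0) (F N)) x = name T \<alpha> (insert (0, 0) (F N)) y" for x y N
    using that unfolding name_eq_iff by force+

  define Q where "Q N = {x \<in> K N. \<exists>y\<in>K N. name T \<alpha> (F N) x = name T \<alpha> (F N) y \<and> \<alpha> 0 x \<noteq> \<alpha> 0 y}" for N
  have QK: "Q N \<subseteq> K N" for N by (auto simp: Q_def)
  have "closed (Q N)" for N
    unfolding closed_sequential_limits
  proof (intro allI impI)
    fix xs x assume xs: "(\<forall>n. xs n \<in> Q N) \<and> xs \<longlonglongrightarrow> x"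
    have xK: "x \<in> K N" using xs QK clK[of N] unfolding closed_sequential_limits by blast
    \<comment> \<open>As soon as \<open>xs n\<close> and \<open>x\<close> agree on these
      coordinates, a twin of \<open>xs n\<close> is itself a twin of \<open>x\<close>; the twins
      need not converge here.\<close>
    have "eventually (\<lambda>n. name T \<alpha> (insert (0, 0) (F N)) (xs n) = name T \<alpha> (insert (0, 0) (F N)) x) sequentially"
      by (rule ev[OF xK]) (use xs QK[of N] in \<open>blast, simp add: subset_iff\<close>)
    then obtain n where "name T \<alpha> (insert (0, 0) (F N)) (xs n) = name T \<alpha> (insert (0, 0) (F N)) x"
      using eventually_happens'[OF sequentially_bot] by blast
    note n = nm0[OF this]
    obtain y where "y \<in> K N" "name T \<alpha> (F N) (xs n) = name T \<alpha> (F N) y" "\<alpha> 0 (xs n) \<noteq> \<alpha> 0 y"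
      using xs unfolding Q_def by blast
    thus "x \<in> Q N" unfolding Q_def using xK n by auto
  qed
  hence cQ: "compact (Q N)" for N
    using compact_Int_closed[OF cK[of N], of "Q N"] QK[of N] by (simp add: Int_absorb1)
  have QX: "Q N \<subseteq> X" for N using QK KX by blast
  have Q_dec: "decseq Q"
  proof (rule decseq_SucI, rule subsetI)
    fix N x assume "x \<in> Q (Suc N)"
    then obtain y where y: "x \<in> K (Suc N)" "y \<in> K (Suc N)"
      "name T \<alpha> (F (Suc N)) x = name T \<alpha> (F (Suc N)) y" "\<alpha> 0 x \<noteq> \<alpha> 0 y"
      unfolding Q_def by blast
    have "name T \<alpha> (F N) x = name T \<alpha> (F N) y"
      using y(3) F_mono[of N "Suc N"] unfolding name_eq_iff by (meson le_SucI le_refl subsetD)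
    thus "x \<in> Q N" using y K_mono[of N "Suc N"] unfolding Q_def by (simp, blast)
  qed
  \<comment> \<open>On \<open>K N - Q N\<close> the name along \<open>F N\<close> determines
    \<open>\<alpha> 0\<close>. If \<open>Q N\<close> were small, \<open>\<alpha> 0\<close> would add
    at most \<open>\<phi> t0 < c\<close> to the entropy of that name, contrary to the choice of the
    delays.\<close>
  have mQ: "m (Q N) \<ge> t0 / 2" for N
  proof (rule ccontr)
    assume less: "\<not> ?thesis"
    let ?B = "(X - K N) \<union> Q N"
    have sK: "X - K N \<in> \<A>" using compl_sets[OF compact_sets[OF cK KX]] .
    have sQ: "Q N \<in> \<A>" using compact_sets[OF cQ QX] .
    have "m ?B \<le> t0" using m_Un_le[OF sK sQ] mK[of N] less by simp
    moreover have "?B \<in> \<A>" using sK sQ by auto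
    ultimately have "ent (\<lambda>x. (\<alpha> 0 x, name T \<alpha> (F N) x)) \<le> ent (name T \<alpha> (F N)) + \<phi> t0"
      unfolding \<phi>_def by (intro ent_nearly_determined simple_\<alpha> simple_name) (auto simp: Q_def)
    moreover have "ent (\<lambda>x. (\<alpha> 0 x, name T \<alpha> (F N) x)) = ent (name T \<alpha> ({(0, 0)} \<union> F N))"
    proof (rule fa_entropy_kernel)
      fix x y
      show "(\<alpha> 0 x, name T \<alpha> (F N) x) = (\<alpha> 0 y, name T \<alpha> (F N) y)
          \<longleftrightarrow> name T \<alpha> ({(0, 0)} \<union> F N) x = name T \<alpha> ({(0, 0)} \<union> F N) y"
        unfolding prod.inject name_eq_iff by force
    qed
    moreover have "cond {(0, 0)} (F N) \<ge> c" using s unfolding F_def by blast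
    ultimately show False using t0(2) unfolding cond_def by simp
  qed
  have "(\<Inter>N. Q N) \<subseteq> {x. \<exists>y. (x, y) \<in> proper_asymptotic_pairs X T}"
  proof
    fix x assume x: "x \<in> (\<Inter>N. Q N)"
    hence xX: "x \<in> X" using QX by blast
    have "\<forall>N. \<exists>y\<in>K N. name T \<alpha> (F N) x = name T \<alpha> (F N) y \<and> \<alpha> 0 x \<noteq> \<alpha> 0 y"
      using x unfolding Q_def by blast
    then obtain ys where ys: "\<And>N. ys N \<in> K N" "\<And>N. name T \<alpha> (F N) x = name T \<alpha> (F N) (ys N)"
      "\<And>N. \<alpha> 0 x \<noteq> \<alpha> 0 (ys N)" by metis
    have "\<forall>N. ys N \<in> X" using ys(1) KX by blast
    then obtain y q where y: "y \<in> X" and q: "strict_mono q" and lim: "(ys \<circ> q) \<longlonglongrightarrow> y"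
      using compact_X unfolding compact_def by blast
    have evK: "eventually (\<lambda>n. (ys \<circ> q) n \<in> K N) sequentially" for N
    proof (rule eventually_sequentiallyI[of N])
      fix n assume "N \<le> n"
      also have "n \<le> q n" using q by (rule seq_suble)
      finally show "(ys \<circ> q) n \<in> K N" using ys(1)[of "q n"] K_mono by auto
    qed
    have yK: "y \<in> K N" for N
      using Lim_in_closed_set[OF clK evK sequentially_bot lim] .
    \<comment> \<open>For large \<open>n\<close>, the twin \<open>ys (q n)\<close> has the name of
      its limit \<open>y\<close> at stage \<open>N\<close> and the same \<open>\<alpha> 0\<close>.
      So \<open>y\<close> inherits both the equality of names and the inequality at
      \<open>\<alpha> 0\<close>, which keeps it apart from \<open>x\<close>.\<close>
    have yN: "name T \<alpha> (F N) x = name T \<alpha> (F N) y \<and> \<alpha> 0 x \<noteq> \<alpha> 0 y" for N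
    proof -
      have "eventually (\<lambda>n. name T \<alpha> (insert (0, 0) (F N)) ((ys \<circ> q) n) = name T \<alpha> (insert (0, 0) (F N)) y
          \<and> n \<ge> N) sequentially"
        using ev[OF yK lim evK] eventually_ge_at_top by (rule eventually_conj)
      then obtain n where n: "n \<ge> N"
        "name T \<alpha> (insert (0, 0) (F N)) ((ys \<circ> q) n) = name T \<alpha> (insert (0, 0) (F N)) y"
        using eventually_happens'[OF sequentially_bot] by blast
      have "N \<le> q n" using n(1) seq_suble[OF q, of n] by simp
      hence "name T \<alpha> (F N) x = name T \<alpha> (F N) (ys (q n))"
        using ys(2)[of "q n"] F_mono[of N "q n"] unfolding name_eq_iff by blast
      thus ?thesis using nm0[OF n(2)] ys(3)[of "q n"] by auto
    qed
    have close: "dist ((T ^^ n) x) ((T ^^ n) y) < 1 / Suc k" if n: "n > s (Suc k)" for n k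
    proof (rule small)
      show "(T ^^ n) x \<in> X" "(T ^^ n) y \<in> X" using xX y T_pow_in by auto
      define t where "t = n - s (Suc k)"
      have t: "1 \<le> t" "n = s (Suc k) + t" using n by (auto simp: t_def)
      \<comment> \<open>This stage contains both the row \<open>Suc k\<close> and the time
        \<open>t\<close>, which is at least 1 since \<open>n\<close> exceeds the delay
        strictly.\<close>
      have "(Suc k, n) \<in> F (Suc k + Suc t)" unfolding t(2) using t(1) by (intro F_mem) auto
      thus "\<alpha> (Suc k) ((T ^^ n) x) = \<alpha> (Suc k) ((T ^^ n) y)"
        using yN[of "Suc k + Suc t"] unfolding name_eq_iff by blast
    qed
    have "(\<lambda>n. dist ((T ^^ n) x) ((T ^^ n) y)) \<longlonglongrightarrow> 0"
    proof (rule LIMSEQ_I)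
      fix r :: real assume "r > 0"
      then obtain k where k: "1 / Suc k < r" using nat_approx_posE by blast
      show "\<exists>no. \<forall>n\<ge>no. norm (dist ((T ^^ n) x) ((T ^^ n) y) - 0) < r"
      proof (intro exI[of _ "Suc (s (Suc k))"] allI impI)
        fix n assume "Suc (s (Suc k)) \<le> n"
        thus "norm (dist ((T ^^ n) x) ((T ^^ n) y) - 0) < r" using close[of k n] k by simp
      qed
    qed
    moreover have "x \<noteq> y" using yN by blast
    ultimately have "(x, y) \<in> proper_asymptotic_pairs X T"
      using xX y by (auto simp: proper_asymptotic_pairs_def asymptotic_pairs_def)
    thus "x \<in> {x. \<exists>y. (x, y) \<in> proper_asymptotic_pairs X T}" by blast
  qed
  thus ?thesis using t0(1) Q_dec cQ QX mQ by (intro exI[of _ Q] exI[of _ "t0 / 2"]) auto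
qed

end

section \<open>Ergodic measures of positive entropy\<close>

lemma iterated_join_cell:
  fixes \<alpha> :: "nat \<Rightarrow> 'a \<Rightarrow> nat"
  assumes cell: "\<And>C x. C \<in> P \<Longrightarrow> x \<in> C \<Longrightarrow> C = {y \<in> X. \<alpha> 0 y = \<alpha> 0 x}"
    and T: "T ` X \<subseteq> X"
  shows "A \<in> iterated_join X T P n \<Longrightarrow> x \<in> A \<Longrightarrow>
    A = {y \<in> X. name T \<alpha> (block {(0, 0)} 0 n) y = name T \<alpha> (block {(0, 0)} 0 n) x}"
proof (induction n arbitrary: A)
  case 0
  thus ?case by (auto simp: block_def name_def)
next
  case (Suc n)
  let ?N = "name T \<alpha> (block {(0, 0)} 0 n)"
  obtain B C where BC: "B \<in> iterated_join X T P n" "C \<in> P" "A = B \<inter> ((T ^^ n) -` C \<inter> X)"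
    using Suc.prems(1) by (auto simp: cover_join_def)
  have B: "B = {y \<in> X. ?N y = ?N x}" using Suc.IH BC Suc.prems(2) by blast
  have C: "C = {y \<in> X. \<alpha> 0 y = \<alpha> 0 ((T ^^ n) x)}" using cell BC Suc.prems(2) by blast
  have "block {(0, 0)} 0 (Suc n) = insert (0, n) (block {(0, 0)} 0 n)"
    by (auto simp: block_def tshift_def less_Suc_eq)
  hence N: "name T \<alpha> (block {(0, 0)} 0 (Suc n)) y = name T \<alpha> (block {(0, 0)} 0 (Suc n)) x
      \<longleftrightarrow> ?N y = ?N x \<and> \<alpha> 0 ((T ^^ n) y) = \<alpha> 0 ((T ^^ n) x)" for y
    unfolding name_eq_iff by auto
  show ?case unfolding N BC(3) using B C funpow_image_subset[OF T] by blast
qed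

lemma Union_iterated_join:
  assumes "\<Union>P = X" "T ` X \<subseteq> X"
  shows "\<Union>(iterated_join X T P n) = X"
proof (induction n)
  case (Suc n)
  show ?case
  proof
    show "\<Union>(iterated_join X T P (Suc n)) \<subseteq> X" by (auto simp: cover_join_def)
    show "X \<subseteq> \<Union>(iterated_join X T P (Suc n))"
    proof
      fix x assume x: "x \<in> X"
      then obtain B where "B \<in> iterated_join X T P n" "x \<in> B" using Suc by blast
      moreover obtain C where "C \<in> P" "(T ^^ n) x \<in> C"
        using funpow_image_subset[OF assms(2) x] assms(1) by blast
      ultimately show "x \<in> \<Union>(iterated_join X T P (Suc n))"
        using x by (auto simp: cover_join_def)
    qed
  qed
qed simp

lemma finite_iterated_join: "finite P \<Longrightarrow> finite (iterated_join X T P n)"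
proof (induction n)
  case (Suc n)
  have "cover_join U V = (\<lambda>(A, B). A \<inter> B) ` (U \<times> V)" for U V :: "'a set set"
    by (auto simp: cover_join_def)
  thus ?case using Suc by simp
qed simp

text \<open>The join may contain the empty set, which is not a fibre; its contribution is
  \<open>eta 0 = 0\<close>.\<close>

lemma partition_entropy_iterated_join:
  fixes \<alpha> :: "nat \<Rightarrow> 'a \<Rightarrow> nat"
  assumes cell: "\<And>C x. C \<in> P \<Longrightarrow> x \<in> C \<Longrightarrow> C = {y \<in> X. \<alpha> 0 y = \<alpha> 0 x}"
    and P: "\<Union>P = X" "finite P" and T: "T ` X \<subseteq> X"
  shows "partition_entropy M (iterated_join X T P n)
    = fa_entropy X (measure M) (name T \<alpha> (block {(0, 0)} 0 n))"
proof -
  let ?J = "iterated_join X T P n" and ?N = "name T \<alpha> (block {(0, 0)} 0 n)"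
  have J: "A = {y \<in> X. ?N y = ?N x}" if "A \<in> ?J" "x \<in> A" for A x
    by (rule iterated_join_cell[where P = P, OF _ T that]) (rule cell)
  have "?J - {{}} = fibres X ?N"
  proof (intro set_eqI iffI)
    fix A assume A: "A \<in> ?J - {{}}"
    then obtain x where x: "x \<in> A" by blast
    hence "A = {y \<in> X. ?N y = ?N x}" using J A by blast
    thus "A \<in> fibres X ?N" using x by (auto simp: fibres_def)
  next
    fix A assume "A \<in> fibres X ?N"
    then obtain x where x: "x \<in> X" "A = {y \<in> X. ?N y = ?N x}" by (auto simp: fibres_def)
    then obtain B where B: "B \<in> ?J" "x \<in> B" using Union_iterated_join[OF P(1) T] by blast
    hence "B = A" using J[OF B] x by simp
    thus "A \<in> ?J - {{}}" using B by auto
  qed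
  moreover have "partition_entropy M ?J = (\<Sum>A\<in>?J - {{}}. eta (measure M A))"
    unfolding partition_entropy_def sum_negf[symmetric] eta_def
    using finite_iterated_join[OF P(2)] by (intro sum.mono_neutral_right) auto
  ultimately show ?thesis by (simp add: fa_entropy_fibres)
qed

text \<open>Inner regularity is proved for \<open>B\<close> and its complement together, so the
  induction over Borel sets handles complements by exchanging \<open>C\<close> and
  \<open>D\<close>.\<close>

lemma closed_inner_approx:
  fixes X :: "'a::metric_space set"
  assumes "finite_measure M" and sets: "sets M = sets (restrict_space borel X)"
    and B: "B \<in> sets borel" and e: "e > 0"
  shows "\<exists>C D. closedin (top_of_set X) C \<and> closedin (top_of_set X) D \<and> C \<subseteq> B \<and> D \<inter> B = {} \<and>
    measure M (X - (C \<union> D)) \<le> e"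
proof -
  interpret finite_measure M by fact
  have space: "space M = X" using sets_eq_imp_space_eq[OF sets] by (simp add: space_restrict_space)
  have closed_in_M: "C \<in> sets M" if "closedin (top_of_set X) C" for C
  proof -
    obtain U where "closed U" "C = X \<inter> U" using \<open>closedin (top_of_set X) C\<close> closedin_closed by blast
    thus ?thesis unfolding sets sets_restrict_space by auto
  qed
  have "sigma_sets UNIV (Collect closed) = sets (borel :: 'a measure)"
    unfolding borel_eq_closed by simp
  with B have "B \<in> sigma_sets UNIV (Collect closed)" by simp
  thus ?thesis using e
  proof (induction B arbitrary: e)
    case (Basic B)
    hence clB: "closed B" by simp
    define D where "D n = X \<inter> {x. 1 / Suc n \<le> infdist x B}" for n :: nat
    have D: "closedin (top_of_set X) (D n)" for n
    proof -
      have "closed {x. 1 / Suc n \<le> infdist x B}"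
        by (intro closed_Collect_le continuous_on_const continuous_on_infdist continuous_on_id)
      thus ?thesis unfolding D_def by (rule closedin_closed_Int)
    qed
    show ?case
    \<comment> \<open>The distance \<open>infdist\<close> to the empty set is 0, so the sets
      \<open>D n\<close> would not exhaust \<open>X\<close> in that case.\<close>
    proof (cases "B = {}")
      case True
      thus ?thesis using Basic.prems by (intro exI[of _ "{}"] exI[of _ X]) auto
    next
      case False
      have DB: "D n \<inter> B = {}" for n by (auto simp: D_def not_le)
      have inc: "incseq D"
      proof (rule incseq_SucI)
        fix n
        have "1 / real (Suc (Suc n)) \<le> 1 / real (Suc n)" by (intro divide_left_mono) auto
        thus "D n \<subseteq> D (Suc n)" unfolding D_def by (auto simp del: of_nat_Suc)
      qed
      have "(\<Union>n. D n) = X - B"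
      proof
        show "X - B \<subseteq> (\<Union>n. D n)"
        proof
          fix x assume x: "x \<in> X - B"
          hence "infdist x B \<noteq> 0" using in_closed_iff_infdist_zero[OF clB False] by auto
          hence "infdist x B > 0" using infdist_nonneg[of x B] by linarith
          then obtain n where "1 / Suc n < infdist x B" using nat_approx_posE by blast
          thus "x \<in> (\<Union>n. D n)" using x by (auto simp: D_def intro!: exI[of _ n])
        qed
      qed (use DB in \<open>auto simp: D_def\<close>)
      hence "(\<lambda>n. measure M (D n)) \<longlonglongrightarrow> measure M (X - B)"
        using finite_Lim_measure_incseq[of D] inc closed_in_M[OF D] by auto
      then obtain n where n: "\<bar>measure M (D n) - measure M (X - B)\<bar> < e"
        using LIMSEQ_D[of _ _ e] Basic.prems by (metis order_refl real_norm_def)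
      have C: "closedin (top_of_set X) (X \<inter> B)" using clB by (rule closedin_closed_Int)
      have XB: "X - B \<in> sets M" using sets.compl_sets[OF closed_in_M[OF C]] by (simp add: space Diff_Int)
      have "X - ((X \<inter> B) \<union> D n) = (X - B) - D n" by auto
      moreover have "measure M ((X - B) - D n) = measure M (X - B) - measure M (D n)"
        using XB closed_in_M[OF D] DB by (intro finite_measure_Diff) (auto simp: D_def)
      ultimately have "measure M (X - ((X \<inter> B) \<union> D n)) \<le> e" using n by simp
      thus ?thesis using C D DB by blast
    qed
  next
    case Empty
    thus ?case by (intro exI[of _ "{}"] exI[of _ X]) auto
  next
    case (Compl B)
    obtain C D where CD: "closedin (top_of_set X) C" "closedin (top_of_set X) D" "C \<subseteq> B"
      "D \<inter> B = {}" "measure M (X - (C \<union> D)) \<le> e" using Compl.IH[OF Compl.prems] by metis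
    thus ?case by (intro exI[of _ D] exI[of _ C]) (auto simp: Un_commute)
  next
    case (Union B)
    have "\<exists>C D. closedin (top_of_set X) C \<and> closedin (top_of_set X) D \<and> C \<subseteq> B i \<and> D \<inter> B i = {} \<and>
        measure M (X - (C \<union> D)) \<le> e / 2 * (1 / 2) ^ Suc i" for i
      using Union.prems by (intro Union.IH) simp
    then obtain C D where C: "\<And>i. closedin (top_of_set X) (C i)" and D: "\<And>i. closedin (top_of_set X) (D i)"
      and CB: "\<And>i. C i \<subseteq> B i" and DB: "\<And>i. D i \<inter> B i = {}"
      and CD: "\<And>i. measure M (X - (C i \<union> D i)) \<le> e / 2 * (1 / 2) ^ Suc i" by metis
    \<comment> \<open>Only finite unions of the \<open>C i\<close> are sure to be closed. Half of
      \<open>e\<close> pays for the errors of all \<open>B i\<close>, the other half for cutting the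
      union off at \<open>n\<close>.\<close>
    define C' where "C' n = (\<Union>i<n. C i)" for n
    define D' where "D' = (\<Inter>i. D i)"
    have C': "closedin (top_of_set X) (C' n)" for n
      unfolding C'_def using C by (intro closedin_Union) auto
    have D': "closedin (top_of_set X) D'" unfolding D'_def using D by (intro closedin_INT) auto
    have mem: "X - (C i \<union> D i) \<in> sets M" for i
      using sets.compl_sets[of "C i \<union> D i" M] closed_in_M[OF C[of i]] closed_in_M[OF D[of i]] by (simp add: space)
    have mem': "X - (C' n \<union> D') \<in> sets M" for n
      using sets.compl_sets[of "C' n \<union> D'" M] closed_in_M[OF C'[of n]] closed_in_M[OF D'] by (simp add: space)
    have dec: "decseq (\<lambda>n. X - (C' n \<union> D'))" unfolding decseq_def C'_def by force
    have lim: "(\<lambda>n. measure M (X - (C' n \<union> D'))) \<longlonglongrightarrow> measure M (\<Inter>n. X - (C' n \<union> D'))"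
      using mem' dec by (intro finite_Lim_measure_decseq) auto
    have sums: "(\<lambda>i. e / 2 * (1 / 2) ^ Suc i) sums (e / 2 * 1)"
      by (intro sums_mult power_half_series)
    have smb: "summable (\<lambda>i. measure M (X - (C i \<union> D i)))"
      using CD by (intro summable_comparison_test'[OF sums_summable[OF sums]]) auto
    have "(\<Inter>n. X - (C' n \<union> D')) \<subseteq> (\<Union>i. X - (C i \<union> D i))" by (auto simp: C'_def D'_def)
    hence "measure M (\<Inter>n. X - (C' n \<union> D')) \<le> measure M (\<Union>i. X - (C i \<union> D i))"
      using sets.countable_UN[of "\<lambda>i. X - (C i \<union> D i)" UNIV M] mem by (intro finite_measure_mono) blast+
    also have "\<dots> \<le> (\<Sum>i. measure M (X - (C i \<union> D i)))"
      using mem smb by (intro finite_measure_subadditive_countably) blast+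
    also have "\<dots> \<le> e / 2"
      using suminf_le[OF CD smb sums_summable[OF sums]] sums_unique[OF sums] by simp
    also have "\<dots> < e" using Union.prems by simp
    finally have "eventually (\<lambda>n. measure M (X - (C' n \<union> D')) < e) sequentially"
      using lim order_tendstoD(2) by blast
    then obtain n where "measure M (X - (C' n \<union> D')) < e"
      using eventually_happens'[OF sequentially_bot] by blast
    hence "measure M (X - (C' n \<union> D')) \<le> e" by (rule less_imp_le)
    moreover have "C' n \<subseteq> \<Union>(range B)" using CB by (force simp: C'_def)
    moreover have "D' \<inter> \<Union>(range B) = {}" using DB by (force simp: D'_def)
    ultimately show ?case using C'[of n] D'
      by (intro exI[of _ "C' n"] exI[of _ D'] conjI)
  qed
qed

text \<open>\<open>E\<close> itself may fail to be measurable. It is enclosed between an invariant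
  set \<open>A\<close> of measure 1 and \<open>X\<close>, and the difference is null in the
  completion.\<close>

lemma measure_asymptotic_points_eq_1:
  fixes X :: "'a::metric_space set"
  assumes X: "compact X" and T: "homeomorphism X X T S"
    and erg: "ergodic_measure X T M" and pos: "measure_entropy M T > 0"
  defines "E \<equiv> {x. \<exists>y. (x, y) \<in> proper_asymptotic_pairs X T}"
  shows "E \<in> sets (completion M) \<and> emeasure (completion M) E = 1"
proof -
  have sets: "sets M = sets (restrict_space borel X)" and TM: "T \<in> M \<rightarrow>\<^sub>M M"
    and inv: "distr M M T = M" and prob: "prob_space M"
    and ergodic: "\<And>A. A \<in> sets M \<Longrightarrow> T -` A \<inter> space M = A \<Longrightarrow> measure M A = 0 \<or> measure M A = 1"
    using erg unfolding ergodic_measure_def by blast+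
  interpret prob_space M by (rule prob)
  have space: "space M = X" using sets_eq_imp_space_eq[OF sets] by (simp add: space_restrict_space)
  have T_in: "T ` X \<subseteq> X" and T_cont: "continuous_on X T"
    using T by (auto simp: homeomorphism_def)
  interpret algebra X "sets M" using sets.algebra_axioms[of M] unfolding space .
  interpret fa_compact X "sets M" "measure M"
  proof unfold_locales
    show "measure M X = 1" using prob_space space by simp
    show "C \<in> sets M" if "compact C" "C \<subseteq> X" for C
      using that compact_imp_closed[OF that(1)] unfolding sets sets_restrict_space
      by (auto intro!: image_eqI[of _ _ C])
    show "compact X" by (rule X)
  qed (auto intro: finite_measure_Union)

  obtain P where P: "finite P" "P \<subseteq> sets M" "partition_on X P"
    and P_pos: "entropy_wrt_partition M T P > 0"
    using pos unfolding measure_entropy_def less_SUP_iff space by auto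
  obtain h :: "'a set \<Rightarrow> nat" where h: "inj_on h P"
    using finite_imp_inj_to_nat_seg[OF P(1)] by blast
  define a where "a x = h (THE A. A \<in> P \<and> x \<in> A)" for x
  have UP: "\<Union>P = X" using P(3) partition_onD1 by blast
  have disj: "A = B" if "A \<in> P" "B \<in> P" "x \<in> A" "x \<in> B" for A B x
    using disjointD[OF partition_onD2[OF P(3)] that(1,2)] that(3,4) by blast
  have a_eq: "a x = h A" if "A \<in> P" "x \<in> A" for x A
    unfolding a_def using that disj by (intro arg_cong[of _ _ h] the_equality) blast+
  have cell: "C = {y \<in> X. a y = a x}" if "C \<in> P" "x \<in> C" for C x
  proof (intro set_eqI iffI)
    fix y assume "y \<in> C"
    thus "y \<in> {y \<in> X. a y = a x}" using a_eq that UP by auto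
  next
    fix y assume y: "y \<in> {y \<in> X. a y = a x}"
    then obtain A where A: "A \<in> P" "y \<in> A" using UP by blast
    hence "h A = h C" using a_eq y that by auto
    hence "A = C" using h A(1) that(1) by (meson inj_onD)
    thus "y \<in> C" using A by simp
  qed
  have a_im: "a ` X \<subseteq> h ` P" using a_eq UP by auto
  have a_fibre: "\<exists>B\<in>sets borel. {x \<in> X. a x = v} = X \<inter> B" for v
  proof (cases "\<exists>x\<in>X. a x = v")
    case True
    then obtain x C where "x \<in> X" "a x = v" "C \<in> P" "x \<in> C" using UP by blast
    hence "{x \<in> X. a x = v} \<in> sets M" using cell[of C x] P(2) by auto
    thus ?thesis unfolding sets sets_restrict_space by auto
  next
    case False
    thus ?thesis by (intro bexI[of _ "{}"]) auto
  qed
  have a_simple: "simple a" unfolding simple_def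
  proof (intro conjI allI)
    show "finite (a ` X)" using a_im P(1) finite_subset by blast
    show "{x \<in> X. a x = v} \<in> sets M" for v
      using a_fibre[of v] unfolding sets sets_restrict_space by auto
  qed
  have a_nc: "nearly_continuous a" unfolding nearly_continuous_def
  proof (intro allI impI)
    fix e :: real assume e: "e > 0"
    define e' where "e' = e / (card (a ` X) + 1)"
    have e': "e' > 0" using e by (simp add: e'_def)
    have "\<forall>v. \<exists>C D. closedin (top_of_set X) C \<and> closedin (top_of_set X) D \<and> C \<subseteq> {x \<in> X. a x = v} \<and>
        D \<inter> {x \<in> X. a x = v} = {} \<and> measure M (X - (C \<union> D)) \<le> e'"
    proof
      fix v
      obtain B where B: "B \<in> sets borel" "{x \<in> X. a x = v} = X \<inter> B" using a_fibre by blast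
      obtain C D where "closedin (top_of_set X) C" "closedin (top_of_set X) D" "C \<subseteq> B" "D \<inter> B = {}"
        "measure M (X - (C \<union> D)) \<le> e'"
        using closed_inner_approx[OF finite_measure_axioms sets B(1) e'] by blast
      thus "\<exists>C D. closedin (top_of_set X) C \<and> closedin (top_of_set X) D \<and> C \<subseteq> {x \<in> X. a x = v} \<and>
        D \<inter> {x \<in> X. a x = v} = {} \<and> measure M (X - (C \<union> D)) \<le> e'"
        unfolding B(2) using closedin_imp_subset[of "top_of_set X" C]
        by (intro exI[of _ C] exI[of _ D]) (auto dest: closedin_imp_subset)
    qed
    then obtain C where "\<forall>v. \<exists>D. closedin (top_of_set X) (C v) \<and> closedin (top_of_set X) D \<and>
        C v \<subseteq> {x \<in> X. a x = v} \<and> D \<inter> {x \<in> X. a x = v} = {} \<and> measure M (X - (C v \<union> D)) \<le> e'"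
      by (rule choice[THEN exE])
    then obtain D where CD_all: "\<forall>v. closedin (top_of_set X) (C v) \<and> closedin (top_of_set X) (D v) \<and>
        C v \<subseteq> {x \<in> X. a x = v} \<and> D v \<inter> {x \<in> X. a x = v} = {} \<and> measure M (X - (C v \<union> D v)) \<le> e'"
      by (rule choice[THEN exE])
    hence C: "\<And>v. closedin (top_of_set X) (C v)" and D: "\<And>v. closedin (top_of_set X) (D v)"
      and Ca: "\<And>v. C v \<subseteq> {x \<in> X. a x = v}" and Da: "\<And>v. D v \<inter> {x \<in> X. a x = v} = {}"
      and CD: "\<And>v. measure M (X - (C v \<union> D v)) \<le> e'" by blast+
    have cC: "compact (C v)" and cD: "compact (D v)" for v
      using C D X closedin_compact by blast+
    define W where "W = (\<Union>v\<in>a ` X. C v)"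
    have fin: "finite (a ` X)" using a_im P(1) finite_subset by blast
    have W: "compact W" unfolding W_def using cC fin by (intro compact_UN) auto
    have WX: "W \<subseteq> X" using Ca by (auto simp: W_def)
    have CX: "C v \<subseteq> X" "D v \<subseteq> X" for v using C D closedin_imp_subset by blast+
    have mem: "X - (C v \<union> D v) \<in> sets M" for v
      using compl_sets[OF Un[OF compact_sets[OF cC CX(1)] compact_sets[OF cD CX(2)]]] .
    \<comment> \<open>A point of the cell \<open>v\<close> outside \<open>C v\<close> also misses
      \<open>D v\<close>, so it lies in the small set \<open>X - (C v \<union> D v)\<close>.\<close>
    have "X - W \<subseteq> (\<Union>v\<in>a ` X. X - (C v \<union> D v))" using Da by (auto simp: W_def)
    hence "measure M (X - W) \<le> measure M (\<Union>v\<in>a ` X. X - (C v \<union> D v))"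
      using finite_UN[OF fin mem] by (rule finite_measure_mono)
    also have "\<dots> \<le> (\<Sum>v\<in>a ` X. measure M (X - (C v \<union> D v)))" using fin mem by (rule m_UN_le)
    also have "\<dots> \<le> (\<Sum>v\<in>a ` X. e')" using CD by (intro sum_mono)
    also have "\<dots> \<le> e" using e by (simp add: e'_def field_simps)
    finally have "measure M (X - W) \<le> e" .
    moreover have "continuous_on W a"
    proof (rule continuous_on_closed_fibres)
      show "finite (a ` W)" using fin WX finite_subset image_mono by metis
      fix v
      show "closed {x \<in> W. a x = v}"
      proof (cases "v \<in> a ` X")
        case True
        have aC: "a x = u" if "x \<in> C u" for x u using Ca[of u] that by blast
        have "{x \<in> W. a x = v} = C v"
        proof (intro set_eqI iffI)
          fix x assume "x \<in> {x \<in> W. a x = v}"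
          then obtain u where "x \<in> C u" "a x = v" by (auto simp: W_def)
          thus "x \<in> C v" using aC by metis
        next
          fix x assume "x \<in> C v"
          thus "x \<in> {x \<in> W. a x = v}" using True aC by (auto simp: W_def)
        qed
        thus ?thesis using compact_imp_closed[OF cC] by simp
      next
        case False
        hence "{x \<in> W. a x = v} = {}" using WX by blast
        thus ?thesis by (simp only: closed_empty)
      qed
    qed
    ultimately show "\<exists>W. compact W \<and> W \<subseteq> X \<and> measure M (X - W) \<le> e \<and> continuous_on W a"
      using W WX by blast
  qed
  have "\<forall>k. \<exists>f :: 'a \<Rightarrow> nat. simple f \<and> nearly_continuous f \<and>
      (\<forall>x\<in>X. \<forall>y\<in>X. f x = f y \<longrightarrow> dist x y < 1 / real (Suc k))"
    by (intro allI exists_small_nearly_continuous) simp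
  then obtain b :: "nat \<Rightarrow> 'a \<Rightarrow> nat" where b: "\<And>k. simple (b k)" "\<And>k. nearly_continuous (b k)"
    "\<And>k x y. x \<in> X \<Longrightarrow> y \<in> X \<Longrightarrow> b k x = b k y \<Longrightarrow> dist x y < 1 / real (Suc k)" by metis
  define \<alpha> where "\<alpha> = case_nat a b"
  interpret fa_compact_system X "sets M" "measure M" T \<alpha>
  proof unfold_locales
    show "T -` A \<inter> X \<in> sets M" if "A \<in> sets M" for A
      using measurable_sets[OF TM that] space by simp
    show "measure M (T -` A \<inter> X) = measure M A" if "A \<in> sets M" for A
      using measure_distr[OF TM that] inv space by simp
    show "simple (\<alpha> k)" for k using a_simple b(1) by (cases k) (auto simp: \<alpha>_def)
  qed (use T_in T_cont in auto)
  have "(\<lambda>n. partition_entropy M (iterated_join (space M) T P n) / real n)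
      = (\<lambda>n. ent (name T \<alpha> (block {(0, 0)} 0 n)) / real n)"
    unfolding space using cell UP P(1) T_in
    by (intro ext arg_cong2[of _ _ _ _ "(/)"] partition_entropy_iterated_join refl) (auto simp: \<alpha>_def)
  \<comment> \<open>The averages are known to converge, so \<open>lim\<close> takes its intended
    value.\<close>
  hence "entropy_wrt_partition M T P = rate {(0, 0)}"
    unfolding entropy_wrt_partition_def using H_block_tendsto[of "{(0, 0)}"] by (simp add: limI)
  hence "rate {(0, 0)} > 0" using P_pos by simp
  moreover have "nearly_continuous (\<alpha> k)" for k using a_nc b(2) by (cases k) (auto simp: \<alpha>_def)
  moreover have "dist x y < 1 / Suc k" if "x \<in> X" "y \<in> X" "\<alpha> (Suc k) x = \<alpha> (Suc k) y" for x y k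
    using b(3) that by (simp add: \<alpha>_def)
  ultimately have "\<exists>Q e. e > 0 \<and> decseq Q \<and> (\<forall>N. compact (Q N) \<and> Q N \<subseteq> X \<and> measure M (Q N) \<ge> e) \<and>
      (\<Inter>N. Q N) \<subseteq> E"
    unfolding E_def by (rule exists_asymptotic_core)
  then obtain Q e where e: "e > 0" and Q: "decseq Q" "\<And>N. compact (Q N)" "\<And>N. Q N \<subseteq> X"
    "\<And>N. measure M (Q N) \<ge> e" and QE: "(\<Inter>N. Q N) \<subseteq> E"
    by blast
  have Q_sets: "Q N \<in> sets M" for N using compact_sets Q by blast
  define R where "R = (\<Inter>N. Q N)"
  have R: "R \<in> sets M" unfolding R_def using Q_sets by auto
  have "(\<lambda>N. measure M (Q N)) \<longlonglongrightarrow> measure M R"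
    unfolding R_def using Q_sets Q(1) by (intro finite_Lim_measure_decseq) auto
  hence mR: "measure M R \<ge> e" using Q(4) by (intro LIMSEQ_le_const) auto

  text \<open>The points visiting \<open>R\<close> infinitely often form a strictly invariant set of positive measure.\<close>
  define V where "V n = (\<Union>i. (T ^^ (n + i)) -` R \<inter> X)" for n
  define A where "A = (\<Inter>n. V n)"
  have V: "V n \<in> sets M" for n unfolding V_def using T_pow_sets[OF R] by (intro sets.countable_UN) blast
  have A: "A \<in> sets M" unfolding A_def using V by auto
  have "V (Suc n) \<subseteq> V n" for n
  proof
    fix x assume "x \<in> V (Suc n)"
    then obtain i where "(T ^^ (n + Suc i)) x \<in> R" "x \<in> X" by (auto simp: V_def)
    thus "x \<in> V n" unfolding V_def by blast
  qed
  hence "decseq V" by (rule decseq_SucI)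
  hence "(\<lambda>n. measure M (V n)) \<longlonglongrightarrow> measure M A"
    unfolding A_def using V by (intro finite_Lim_measure_decseq) auto
  moreover have "e \<le> measure M (V n)" for n
  proof -
    have "(T ^^ (n + 0)) -` R \<inter> X \<subseteq> V n" unfolding V_def by blast
    hence "measure M ((T ^^ n) -` R \<inter> X) \<le> measure M (V n)" using V by (intro finite_measure_mono) auto
    thus ?thesis using mR m_inv_pow[OF R, of n] by simp
  qed
  ultimately have mA: "measure M A \<ge> e" by (intro LIMSEQ_le_const) auto
  have A_iff: "x \<in> A \<longleftrightarrow> x \<in> X \<and> (\<forall>n. \<exists>i\<ge>n. (T ^^ i) x \<in> R)" for x
    unfolding A_def V_def by (auto simp: le_iff_add)
  have "T -` A \<inter> X = A"
  proof (intro set_eqI iffI)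
    fix x assume "x \<in> T -` A \<inter> X"
    hence x: "x \<in> X" and "\<And>n. \<exists>i\<ge>n. (T ^^ i) (T x) \<in> R" by (auto simp: A_iff)
    hence "\<exists>i\<ge>n. (T ^^ i) x \<in> R" for n
      by (metis funpow_Suc_right comp_apply le_SucI)
    thus "x \<in> A" using x by (simp add: A_iff)
  next
    fix x assume x: "x \<in> A"
    have "\<exists>i\<ge>n. (T ^^ i) (T x) \<in> R" for n
    proof -
      obtain i where i: "i \<ge> Suc n" "(T ^^ i) x \<in> R" using x by (auto simp: A_iff)
      then obtain j where "i = Suc j" "j \<ge> n" by (metis Suc_le_D Suc_le_mono)
      thus ?thesis using i by (metis funpow_Suc_right comp_apply)
    qed
    thus "x \<in> T -` A \<inter> X" using x T_in by (auto simp: A_iff)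
  qed
  hence A1: "measure M A = 1" using ergodic[OF A] mA e space by auto

  \<comment> \<open>Surjectivity of \<open>T\<close> provides a preimage \<open>y\<close> in
    \<open>X\<close> of the twin of \<open>T x\<close>. It differs from \<open>x\<close> because its
    image differs from \<open>T x\<close>.\<close>
  have pull: "x \<in> E" if x: "x \<in> X" "(T ^^ i) x \<in> E" for x i
    using x
  proof (induction i arbitrary: x)
    case (Suc i)
    have "T x \<in> E" using Suc T_in by (auto simp: funpow_swap1)
    then obtain z where z: "z \<in> X" "(\<lambda>n. dist ((T ^^ n) (T x)) ((T ^^ n) z)) \<longlonglongrightarrow> 0" "T x \<noteq> z"
      unfolding E_def proper_asymptotic_pairs_def asymptotic_pairs_def by auto
    obtain y where y: "y \<in> X" "T y = z" using z(1) T unfolding homeomorphism_def by blast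
    have "(\<lambda>n. dist ((T ^^ Suc n) x) ((T ^^ Suc n) y)) \<longlonglongrightarrow> 0"
      using z(2) y(2) by (simp add: funpow_swap1)
    hence "(\<lambda>n. dist ((T ^^ n) x) ((T ^^ n) y)) \<longlonglongrightarrow> 0" by (rule LIMSEQ_imp_Suc)
    thus ?case using Suc.prems(1) y z(3)
      unfolding E_def proper_asymptotic_pairs_def asymptotic_pairs_def by auto
  qed simp
  have AE: "A \<subseteq> E"
  proof
    fix x assume "x \<in> A"
    then obtain i where "x \<in> X" "(T ^^ i) x \<in> R" by (auto simp: A_iff)
    thus "x \<in> E" using pull QE unfolding R_def by blast
  qed
  have EX: "E \<subseteq> X" by (auto simp: E_def proper_asymptotic_pairs_def asymptotic_pairs_def)
  have "X - A \<in> null_sets M"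
    using m_compl[OF A] A1 compl_sets[OF A] by (auto simp: null_sets_def emeasure_eq_measure)
  hence N: "E - A \<in> null_sets (completion M)"
    using EX by (intro null_sets_completion_subset[of "E - A" "X - A"] null_sets_completionI) auto
  have A': "A \<in> sets (completion M)" using A by (rule sets_completionI_sets)
  have "E = A \<union> (E - A)" using AE by auto
  moreover have "A \<union> (E - A) \<in> sets (completion M)" using A' N by (intro sets.Un) auto
  moreover have "emeasure (completion M) (A \<union> (E - A)) = emeasure (completion M) A"
    using A' N by (rule emeasure_Un_null_set)
  moreover have "emeasure (completion M) A = 1"
    using A A1 by (simp add: emeasure_eq_measure)
  ultimately show ?thesis by metis
qed

section \<open>Positive topological entropy\<close>

lemma bowen_ball_subset_iterated_join:
  assumes T: "T ` X \<subseteq> X"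
    and leb: "\<And>x. x \<in> X \<Longrightarrow> \<exists>U\<in>\<U>. X \<inter> ball x d \<subseteq> U"
    and x: "x \<in> X"
  shows "\<exists>V\<in>iterated_join X T \<U> n. {y \<in> X. \<forall>i<n. dist ((T ^^ i) x) ((T ^^ i) y) < d} \<subseteq> V"
proof (induction n)
  case (Suc n)
  then obtain V where V: "V \<in> iterated_join X T \<U> n"
    "{y \<in> X. \<forall>i<n. dist ((T ^^ i) x) ((T ^^ i) y) < d} \<subseteq> V" by blast
  obtain U where U: "U \<in> \<U>" "X \<inter> ball ((T ^^ n) x) d \<subseteq> U"
    using leb[OF funpow_image_subset[OF T x]] by blast
  have "V \<inter> ((T ^^ n) -` U \<inter> X) \<in> iterated_join X T \<U> (Suc n)"
    using V(1) U(1) by (auto simp: cover_join_def)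
  moreover have "{y \<in> X. \<forall>i<Suc n. dist ((T ^^ i) x) ((T ^^ i) y) < d} \<subseteq> V \<inter> ((T ^^ n) -` U \<inter> X)"
  proof
    fix y assume y: "y \<in> {y \<in> X. \<forall>i<Suc n. dist ((T ^^ i) x) ((T ^^ i) y) < d}"
    hence "y \<in> V" using V(2) by auto
    moreover have "(T ^^ n) y \<in> X \<inter> ball ((T ^^ n) x) d" using y funpow_image_subset[OF T] by auto
    ultimately show "y \<in> V \<inter> ((T ^^ n) -` U \<inter> X)" using U(2) y by blast
  qed
  ultimately show ?case by blast
qed simp

lemma iterated_join_subset: "A \<in> iterated_join X T \<U> n \<Longrightarrow> A \<subseteq> X"
  by (induction n arbitrary: A) (auto simp: cover_join_def)

text \<open>A greedy choice. The Bowen balls around fewer than \<open>min_subcover_card\<close>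
  points lie in as many members of the join; these cannot cover \<open>X\<close>, so a further
  separated point exists.\<close>

lemma exists_separated_set:
  assumes T: "T ` X \<subseteq> X"
    and leb: "\<And>x. x \<in> X \<Longrightarrow> \<exists>U\<in>\<U>. X \<inter> ball x d \<subseteq> U" and d: "d > 0"
    and j: "j \<le> min_subcover_card X (iterated_join X T \<U> n)"
  shows "\<exists>E\<subseteq>X. finite E \<and> card E = j \<and>
    (\<forall>x\<in>E. \<forall>y\<in>E. x \<noteq> y \<longrightarrow> (\<exists>i<n. dist ((T ^^ i) x) ((T ^^ i) y) \<ge> d))"
  using j
proof (induction j)
  case 0
  show ?case by (intro exI[of _ "{}"]) auto
next
  case (Suc j)
  let ?J = "iterated_join X T \<U> n"
  obtain E where E: "E \<subseteq> X" "finite E" "card E = j"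
    "\<And>x y. x \<in> E \<Longrightarrow> y \<in> E \<Longrightarrow> x \<noteq> y \<Longrightarrow> \<exists>i<n. dist ((T ^^ i) x) ((T ^^ i) y) \<ge> d"
    using Suc by (meson Suc_leD)
  have "\<forall>x\<in>E. \<exists>V\<in>?J. {y \<in> X. \<forall>i<n. dist ((T ^^ i) x) ((T ^^ i) y) < d} \<subseteq> V"
    using bowen_ball_subset_iterated_join[OF T leb] E(1) by blast
  then have "\<forall>x\<in>E. \<exists>V. V \<in> ?J \<and> {y \<in> X. \<forall>i<n. dist ((T ^^ i) x) ((T ^^ i) y) < d} \<subseteq> V" by blast
  then obtain V where "\<forall>x\<in>E. V x \<in> ?J \<and> {y \<in> X. \<forall>i<n. dist ((T ^^ i) x) ((T ^^ i) y) < d} \<subseteq> V x"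
    by (rule bchoice[THEN exE])
  hence V: "\<And>x. x \<in> E \<Longrightarrow> V x \<in> ?J"
    "\<And>x. x \<in> E \<Longrightarrow> {y \<in> X. \<forall>i<n. dist ((T ^^ i) x) ((T ^^ i) y) < d} \<subseteq> V x"
    by blast+
  have "card (V ` E) \<le> j" using card_image_le[OF E(2), of V] E(3) by simp
  hence "card (V ` E) < min_subcover_card X ?J" using Suc.prems by simp
  hence "\<not> (\<exists>\<V>\<subseteq>?J. finite \<V> \<and> \<Union>\<V> = X \<and> card \<V> = card (V ` E))"
    unfolding min_subcover_card_def by (rule not_less_Least)
  moreover have "V ` E \<subseteq> ?J" "finite (V ` E)" using V(1) E(2) by auto
  ultimately have "\<Union>(V ` E) \<noteq> X" by metis
  moreover have "\<Union>(V ` E) \<subseteq> X" using V(1) iterated_join_subset by blast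
  ultimately obtain z where z: "z \<in> X" "z \<notin> \<Union>(V ` E)" by blast
  have far: "\<exists>i<n. dist ((T ^^ i) x) ((T ^^ i) z) \<ge> d" if "x \<in> E" for x
  proof (rule ccontr)
    assume "\<not> ?thesis"
    hence "z \<in> {y \<in> X. \<forall>i<n. dist ((T ^^ i) x) ((T ^^ i) y) < d}" using z by (auto simp: not_le)
    thus False using V(2)[OF that] z(2) that by blast
  qed
  have "z \<notin> E"
    using far[of z] d by auto
  hence "card (insert z E) = Suc j" using E by simp
  moreover have "\<exists>i<n. dist ((T ^^ i) x) ((T ^^ i) y) \<ge> d"
    if "x \<in> insert z E" "y \<in> insert z E" "x \<noteq> y" for x y
    using that E(4) far by (auto simp: dist_commute)
  ultimately show ?case using E z by (intro exI[of _ "insert z E"]) auto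
qed

text \<open>The members of the cover are open only relative to \<open>X\<close>; they are extended
  to open sets of the whole space first.\<close>

lemma Lebesgue_number_open_cover:
  fixes X :: "'a::metric_space set"
  assumes X: "compact X" and U: "open_cover X \<U>"
  shows "\<exists>d>0. \<forall>x\<in>X. \<exists>U\<in>\<U>. X \<inter> ball x d \<subseteq> U"
proof -
  define G where "G = {V. open V \<and> X \<inter> V \<in> \<U>}"
  have "X \<subseteq> \<Union>G"
  proof
    fix x assume "x \<in> X"
    then obtain A where A: "A \<in> \<U>" "x \<in> A" using U unfolding open_cover_def by blast
    then obtain V where "open V" "A = X \<inter> V" using U unfolding open_cover_def openin_open by blast
    thus "x \<in> \<Union>G" using A unfolding G_def by blast
  qed
  then obtain d where d: "0 < d" "\<And>x. x \<in> X \<Longrightarrow> \<exists>V\<in>G. ball x d \<subseteq> V"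
    using Heine_Borel_lemma[OF X, of G] unfolding G_def by blast
  have "\<exists>U\<in>\<U>. X \<inter> ball x d \<subseteq> U" if x: "x \<in> X" for x
  proof -
    obtain V where "V \<in> G" "ball x d \<subseteq> V" using d(2)[OF x] by blast
    thus ?thesis unfolding G_def by blast
  qed
  thus ?thesis using d(1) by blast
qed

text \<open>A sequence whose \<open>lim\<close> is positive cannot tend to 0. As its terms are
  nonnegative, some \<open>c > 0\<close> is reached infinitely often, and this is all the averages
  over orbits require.\<close>

lemma cover_entropy_pos_imp_growth:
  assumes "cover_entropy X T \<U> > 0"
  shows "\<exists>c::real. c > 0 \<and> (\<forall>k::nat. \<exists>n>k. ln (real (min_subcover_card X (iterated_join X T \<U> n))) \<ge> c * n)"
proof -
  define a where "a n = ln (real (min_subcover_card X (iterated_join X T \<U> n))) / real n" for n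
  have a0: "a n \<ge> 0" for n
    unfolding a_def by (cases "min_subcover_card X (iterated_join X T \<U> n) = 0") auto
  have "\<not> a \<longlonglongrightarrow> 0"
  proof
    assume "a \<longlonglongrightarrow> 0"
    hence "lim a = 0" by (rule limI)
    moreover have "cover_entropy X T \<U> = lim a" unfolding cover_entropy_def a_def ..
    ultimately show False using assms by simp
  qed
  then obtain c where c: "c > 0" "\<And>k. \<exists>n\<ge>k. a n \<ge> c"
    unfolding LIMSEQ_def using a0 by (auto simp: dist_real_def not_less)
  have "\<exists>n>k. ln (real (min_subcover_card X (iterated_join X T \<U> n))) \<ge> c * n" for k :: nat
  proof -
    obtain n where n: "n \<ge> Suc k" "a n \<ge> c" using c(2) by blast
    thus ?thesis unfolding a_def by (intro exI[of _ n]) (auto simp: field_simps)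
  qed
  thus ?thesis using c(1) by (intro exI[of _ c] conjI allI)
qed

lemma exists_separated_sets:
  fixes X :: "'a::metric_space set"
  assumes X: "compact X" and T: "T ` X \<subseteq> X" and pos: "topological_entropy X T > 0"
  shows "\<exists>(c::real) d. c > 0 \<and> d > 0 \<and> (\<forall>k::nat. \<exists>n>k. \<exists>E\<subseteq>X. finite E \<and> E \<noteq> {} \<and> ln (card E) \<ge> c * n \<and>
    (\<forall>x\<in>E. \<forall>y\<in>E. x \<noteq> y \<longrightarrow> (\<exists>i<n. dist ((T ^^ i) x) ((T ^^ i) y) \<ge> d)))"
proof -
  obtain \<U> where U: "open_cover X \<U>" "cover_entropy X T \<U> > 0"
    using pos unfolding topological_entropy_def less_SUP_iff by auto
  obtain d where d: "d > 0" "\<And>x. x \<in> X \<Longrightarrow> \<exists>U\<in>\<U>. X \<inter> ball x d \<subseteq> U"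
    using Lebesgue_number_open_cover[OF X U(1)] by blast
  obtain c :: real where c: "c > 0"
    "\<forall>k::nat. \<exists>n>k. ln (real (min_subcover_card X (iterated_join X T \<U> n))) \<ge> c * n"
    using cover_entropy_pos_imp_growth[OF U(2)] by (elim exE conjE)
  have "\<exists>n>k. \<exists>E\<subseteq>X. finite E \<and> E \<noteq> {} \<and> ln (card E) \<ge> c * n \<and>
    (\<forall>x\<in>E. \<forall>y\<in>E. x \<noteq> y \<longrightarrow> (\<exists>i<n. dist ((T ^^ i) x) ((T ^^ i) y) \<ge> d))" for k :: nat
  proof -
    obtain n where n: "n > k" "ln (real (min_subcover_card X (iterated_join X T \<U> n))) \<ge> c * n"
      using spec[OF c(2), of k] by (elim exE conjE)
    obtain E where E: "E \<subseteq> X" "finite E" "card E = min_subcover_card X (iterated_join X T \<U> n)"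
      "\<forall>x\<in>E. \<forall>y\<in>E. x \<noteq> y \<longrightarrow> (\<exists>i<n. dist ((T ^^ i) x) ((T ^^ i) y) \<ge> d)"
      using exists_separated_set[OF T d(2) d(1) order_refl] by metis
    have ge: "ln (card E) \<ge> c * n" using n(2) E(3) by simp
    have "c * n > 0" using c(1) n(1) by simp
    hence "E \<noteq> {}" using ge by auto
    thus ?thesis using n(1) E ge by blast
  qed
  thus ?thesis using c(1) d(1) by (intro exI[of _ c] exI[of _ d] conjI allI)
qed

text \<open>The set functions are points of a compact product of unit intervals, and
  \<open>m\<close> is a cluster point. With uncountably many factors a convergent subsequence may
  not exist; the filter \<open>G\<close> takes its place.\<close>

lemma set_function_limit:
  fixes \<mu> :: "nat \<Rightarrow> 'b \<Rightarrow> real"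
  assumes "\<And>n A. \<mu> n A \<in> {0..1}"
  shows "\<exists>G m. G \<noteq> bot \<and> G \<le> sequentially \<and> (\<forall>A. ((\<lambda>n. \<mu> n A) \<longlongrightarrow> m A) G)"
proof -
  define K where "K = (PiE UNIV (\<lambda>_. {0..1}) :: ('b \<Rightarrow> real) set)"
  have "compactin (product_topology (\<lambda>_. euclidean) UNIV) K"
    unfolding K_def compactin_PiE by auto
  hence "compact K" unfolding euclidean_product_topology by simp
  moreover have "filtermap \<mu> sequentially \<noteq> bot" by (simp add: filtermap_bot_iff)
  moreover have "eventually (\<lambda>x. x \<in> K) (filtermap \<mu> sequentially)"
    using assms by (auto simp: eventually_filtermap K_def PiE_UNIV_domain)
  ultimately obtain m where m: "inf (nhds m) (filtermap \<mu> sequentially) \<noteq> bot"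
    unfolding compact_filter by blast
  define G where "G = inf sequentially (filtercomap \<mu> (nhds m))"
  have "G \<noteq> bot"
  proof
    assume "G = bot"
    hence "eventually (\<lambda>_. False) G" by simp
    then obtain P Q where P: "eventually P sequentially" and Q: "eventually Q (filtercomap \<mu> (nhds m))"
      and PQ: "\<And>n. P n \<Longrightarrow> Q n \<Longrightarrow> False"
      unfolding G_def eventually_inf by blast
    obtain R where R: "eventually R (nhds m)" "\<And>n. R (\<mu> n) \<Longrightarrow> Q n"
      using Q unfolding eventually_filtercomap by blast
    have "eventually (\<lambda>x. \<not> R x) (filtermap \<mu> sequentially)"
      unfolding eventually_filtermap using P by (rule eventually_mono) (use PQ R(2) in blast)
    hence "eventually (\<lambda>_. False) (inf (nhds m) (filtermap \<mu> sequentially))"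
      unfolding eventually_inf using R(1) by blast
    thus False using m by (simp add: eventually_False)
  qed
  moreover have "G \<le> sequentially" by (simp add: G_def)
  moreover have "((\<lambda>n. \<mu> n A) \<longlongrightarrow> m A) G" for A
  proof -
    have "filterlim \<mu> (nhds m) (filtercomap \<mu> (nhds m))" by (rule filterlim_filtercomap)
    hence "filterlim \<mu> (nhds m) G" by (rule filterlim_mono) (auto simp: G_def)
    moreover have "filterlim (\<lambda>x :: 'b \<Rightarrow> real. x A) (nhds (m A)) (nhds m)"
    proof (rule topological_tendstoI)
      fix S :: "real set" assume S: "open S" "m A \<in> S"
      have "open ((\<lambda>x :: 'b \<Rightarrow> real. x A) -` S)"
        using S(1) continuous_on_product_coordinates by (rule open_vimage)
      thus "eventually (\<lambda>x. x A \<in> S) (nhds m)"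
        using S(2) unfolding eventually_nhds by (intro exI[of _ "(\<lambda>x. x A) -` S"]) auto
    qed
    ultimately show ?thesis using filterlim_compose by blast
  qed
  ultimately show ?thesis by blast
qed

section \<open>Entropy under limits and averages\<close>

lemma tendsto_eta:
  assumes f: "(f \<longlongrightarrow> p) G" and f01: "eventually (\<lambda>n. 0 \<le> f n \<and> f n \<le> 1) G" and p: "p \<ge> 0"
  shows "((\<lambda>n. eta (f n)) \<longlongrightarrow> eta p) G"
proof (cases "p = 0")
  case False
  thus ?thesis unfolding eta_def using f p by (intro tendsto_intros) auto
next
  case True
  \<comment> \<open>The logarithm is not continuous at 0; the square root bound takes over.\<close>
  have "((\<lambda>n. eta (f n)) \<longlongrightarrow> 0) G"
  proof (rule tendsto_sandwich)
    show "eventually (\<lambda>n. 0 \<le> eta (f n)) G"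
      using f01 by (rule eventually_mono) (auto intro: eta_nonneg)
    show "eventually (\<lambda>n. eta (f n) \<le> 2 * sqrt (f n)) G"
      using f01 by (rule eventually_mono) (auto intro: eta_le_sqrt)
    have "((\<lambda>n. 2 * sqrt (f n)) \<longlongrightarrow> 2 * sqrt p) G" by (intro tendsto_intros f)
    thus "((\<lambda>n. 2 * sqrt (f n)) \<longlongrightarrow> 0) G" using True by simp
  qed simp
  thus ?thesis using True by simp
qed

text \<open>Jensen's inequality, cell by cell: \<open>eta\<close> is bounded by its tangent at the
  mean \<open>q\<close>, and the linear terms cancel in the sum.\<close>

lemma fa_entropy_average_ge:
  fixes p :: "nat \<Rightarrow> 'a set \<Rightarrow> real"
  assumes n: "n > 0" and p: "\<And>i v. p i {x \<in> X. f x = v} \<ge> 0"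
  shows "(\<Sum>i<n. fa_entropy X (p i) f) \<le> n * fa_entropy X (\<lambda>A. (\<Sum>i<n. p i A) / n) f"
proof -
  have "(\<Sum>i<n. eta (p i {x \<in> X. f x = v})) \<le> n * eta ((\<Sum>i<n. p i {x \<in> X. f x = v}) / n)" for v
  proof -
    let ?p = "\<lambda>i. p i {x \<in> X. f x = v}"
    define q where "q = (\<Sum>i<n. ?p i) / n"
    have sum: "(\<Sum>i<n. ?p i) = n * q" using n by (simp add: q_def)
    show ?thesis
    proof (cases "q = 0")
      case True
      hence "(\<Sum>i<n. ?p i) = 0" using sum by simp
      hence "\<forall>i\<in>{..<n}. ?p i = 0" using p by (subst (asm) sum_nonneg_eq_0_iff) auto
      thus ?thesis by simp
    next
      case False
      have "q \<ge> 0" unfolding q_def using p by (intro divide_nonneg_nonneg sum_nonneg) auto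
      hence q: "q > 0" using False by simp
      have "(\<Sum>i<n. eta (?p i)) \<le> (\<Sum>i<n. - ?p i * ln q + (q - ?p i))"
        using p q by (intro sum_mono eta_le_tangent)
      also have "\<dots> = - (\<Sum>i<n. ?p i) * ln q + (n * q - (\<Sum>i<n. ?p i))"
        by (simp add: sum.distrib sum_subtractf sum_negf sum_distrib_right)
      also have "\<dots> = n * eta q" unfolding sum by (simp add: eta_def)
      finally show ?thesis by (simp add: q_def)
    qed
  qed
  hence "(\<Sum>v\<in>f ` X. \<Sum>i<n. eta (p i {x \<in> X. f x = v}))
      \<le> (\<Sum>v\<in>f ` X. n * eta ((\<Sum>i<n. p i {x \<in> X. f x = v}) / n))" by (intro sum_mono)
  thus ?thesis unfolding fa_entropy_def by (subst sum.swap) (simp add: sum_distrib_left)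
qed

lemma fa_prob_uniform:
  assumes "finite E" "E \<noteq> {}" "E \<subseteq> X"
  shows "fa_prob X (Pow X) (\<lambda>A. card (E \<inter> A) / card E)"
proof -
  interpret algebra X "Pow X" by (rule algebra_Pow)
  show ?thesis
  proof unfold_locales
    show "card (E \<inter> X) / card E = (1 :: real)" using assms by (simp add: Int_absorb2)
  next
    fix A B :: "'a set" assume AB: "A \<inter> B = {}"
    have "card (E \<inter> (A \<union> B)) = card (E \<inter> A) + card (E \<inter> B)"
      unfolding Int_Un_distrib using assms AB by (intro card_Un_disjoint) auto
    thus "card (E \<inter> (A \<union> B)) / card E = card (E \<inter> A) / card E + (card (E \<inter> B) / card E :: real)"
      by (simp add: add_divide_distrib)
  qed simp
qed

lemma fa_entropy_uniform_inj:
  assumes E: "finite E" "E \<noteq> {}" "E \<subseteq> X" and inj: "inj_on f E" and fin: "finite (f ` X)"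
  shows "fa_entropy X (\<lambda>A. card (E \<inter> A) / card E) f = ln (card E)"
proof -
  have "fa_entropy X (\<lambda>A. card (E \<inter> A) / card E) f
      = (\<Sum>v\<in>f ` E. eta (card (E \<inter> {x \<in> X. f x = v}) / card E))"
    unfolding fa_entropy_def
  proof (rule sum.mono_neutral_right)
    show "\<forall>v\<in>f ` X - f ` E. eta (card (E \<inter> {x \<in> X. f x = v}) / card E) = 0"
    proof
      fix v assume "v \<in> f ` X - f ` E"
      hence "v \<notin> f ` E" by blast
      hence "E \<inter> {x \<in> X. f x = v} = {}" by blast
      thus "eta (card (E \<inter> {x \<in> X. f x = v}) / card E) = 0" by (simp only: card.empty) simp
    qed
  qed (use E fin in auto)
  also have "\<dots> = (\<Sum>v\<in>f ` E. ln (card E) / card E)"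
  proof (rule sum.cong[OF refl])
    fix v assume "v \<in> f ` E"
    then obtain x where x: "x \<in> E" "v = f x" by blast
    hence "E \<inter> {y \<in> X. f y = v} = {x}" using inj E(3) by (auto simp: inj_on_def)
    hence "card (E \<inter> {y \<in> X. f y = v}) = 1" by simp
    moreover have "card E > 0" using E by (simp add: card_gt_0_iff)
    ultimately show "eta (card (E \<inter> {x \<in> X. f x = v}) / card E) = ln (card E) / card E"
      by (simp add: eta_def ln_div)
  qed
  also have "\<dots> = ln (card E)" using E card_image[OF inj] by simp
  finally show ?thesis .
qed

text \<open>Let \<open>g t\<close> be the entropy of the block of length \<open>t\<close>. Each
  increment \<open>g (i + q) - g i\<close> is at most the entropy of the window of length
  \<open>q\<close> at time \<open>i\<close>; summed over \<open>i < n\<close> the increments give at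
  least \<open>q * (g n - g q)\<close>. The cardinality is a crude bound for
  \<open>g q\<close>.\<close>

lemma (in fa_coded_map) average_entropy_ge:
  assumes n: "n > 0"
  defines "O1 \<equiv> {(0, 0)} :: (nat \<times> nat) set"
  shows "q * ent (name T \<alpha> (block O1 0 n)) \<le>
    n * fa_entropy X (\<lambda>A. (\<Sum>i<n. m ((T ^^ i) -` A \<inter> X)) / n) (name T \<alpha> (block O1 0 q))
    + q * card (name T \<alpha> (block O1 0 q) ` X)"
proof -
  define g where "g t = ent (name T \<alpha> (block O1 0 t))" for t
  have fin [simp]: "finite (block O1 i j)" for i j by (simp add: O1_def)
  have ent_nonneg: "ent (name T \<alpha> I) \<ge> 0" if "finite I" for I
    using that ent_name_mono[of I "{}"] fa_entropy_kernel[of X "name T \<alpha> {}" "\<lambda>_. ()" m]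
    by (simp add: name_eq_iff)
  have g_mono: "g s \<le> g t" if "s \<le> t" for s t
    unfolding g_def using that by (intro ent_name_mono block_mono) auto
  have g_diff: "g (i + q) - g i \<le> fa_entropy X (\<lambda>A. m ((T ^^ i) -` A \<inter> X)) (name T \<alpha> (block O1 0 q))" for i
  proof -
    have "ent (name T \<alpha> (block O1 0 i \<union> block O1 i (i + q))) + ent (name T \<alpha> (block O1 0 i \<inter> block O1 i (i + q)))
        \<le> ent (name T \<alpha> (block O1 0 i)) + ent (name T \<alpha> (block O1 i (i + q)))"
      by (intro ent_name_submodular) auto
    moreover have "block O1 0 i \<union> block O1 i (i + q) = block O1 0 (i + q)"
      by (rule block_split[symmetric]) auto
    moreover have "block O1 i (i + q) = tshift i (block O1 0 q)" by (simp add: shift_block add.commute)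
    moreover have "ent (name T \<alpha> (block O1 0 i \<inter> block O1 i (i + q))) \<ge> 0" by (intro ent_nonneg) auto
    moreover have "ent (name T \<alpha> (tshift i (block O1 0 q)))
        = fa_entropy X (\<lambda>A. m ((T ^^ i) -` A \<inter> X)) (name T \<alpha> (block O1 0 q))"
      by (rule ent_name_tshift_pow) simp
    ultimately show ?thesis unfolding g_def by simp
  qed
  \<comment> \<open>Both sides sum the unit increments of \<open>g\<close> over the same rectangle
    of \<open>n\<close> by \<open>q\<close> indices.\<close>
  have tel: "(\<Sum>i<n. g (i + q) - g i) = (\<Sum>t<q. g (n + t) - g t)" for n
  proof (induction n)
    case (Suc n)
    have "(\<Sum>t<q. g (Suc n + t) - g (n + t)) = g (n + q) - g n"
      using sum_lessThan_telescope[of "\<lambda>t. g (n + t)" q] by simp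
    moreover have "(\<Sum>t<q. g (Suc n + t) - g t) = (\<Sum>t<q. g (Suc n + t) - g (n + t)) + (\<Sum>t<q. g (n + t) - g t)"
      by (simp flip: sum.distrib)
    ultimately show ?case using Suc by simp
  qed simp
  have "q * (g n - g q) = (\<Sum>t<q. g n - g q)" by simp
  also have "\<dots> \<le> (\<Sum>t<q. g (n + t) - g t)" by (intro sum_mono diff_mono g_mono) auto
  also have "\<dots> = (\<Sum>i<n. g (i + q) - g i)" by (rule tel[symmetric])
  also have "\<dots> \<le> (\<Sum>i<n. fa_entropy X (\<lambda>A. m ((T ^^ i) -` A \<inter> X)) (name T \<alpha> (block O1 0 q)))"
    by (intro sum_mono g_diff)
  also have "\<dots> \<le> n * fa_entropy X (\<lambda>A. (\<Sum>i<n. m ((T ^^ i) -` A \<inter> X)) / n) (name T \<alpha> (block O1 0 q))"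
  proof (rule fa_entropy_average_ge[OF n])
    fix i v
    show "m ((T ^^ i) -` {x \<in> X. name T \<alpha> (block O1 0 q) x = v} \<inter> X) \<ge> 0"
      by (intro m_nonneg T_pow_sets simple_sets simple_name) simp
  qed
  finally have "q * g n - q * g q
      \<le> n * fa_entropy X (\<lambda>A. (\<Sum>i<n. m ((T ^^ i) -` A \<inter> X)) / n) (name T \<alpha> (block O1 0 q))"
    by (simp add: right_diff_distrib)
  moreover have "g q \<le> card (name T \<alpha> (block O1 0 q) ` X)"
    unfolding g_def by (intro ent_le_card simple_name) simp
  hence "q * g q \<le> q * card (name T \<alpha> (block O1 0 q) ` X)"
    by (simp add: mult_left_mono)
  ultimately show ?thesis unfolding g_def by linarith
qed

lemma decseq_compact_nonempty:
  fixes Q :: "nat \<Rightarrow> 'a::metric_space set"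
  assumes "decseq Q" "\<And>n. compact (Q n)" "\<And>n. Q n \<noteq> {}"
  shows "(\<Inter>n. Q n) \<noteq> {}"
proof -
  have "Q 0 \<inter> (\<Inter>n\<in>UNIV. Q n) \<noteq> {}"
  proof (rule compact_imp_fip_image)
    fix I :: "nat set" assume I: "finite I"
    have "Q (Max (insert 0 I)) \<subseteq> Q n" if "n \<in> insert 0 I" for n
      using assms(1) that I unfolding decseq_def by (simp del: Max_insert)
    hence "Q (Max (insert 0 I)) \<subseteq> Q 0 \<inter> (\<Inter>n\<in>I. Q n)" by blast
    thus "Q 0 \<inter> (\<Inter>n\<in>I. Q n) \<noteq> {}" using assms(3)[of "Max (insert 0 I)"] by blast
  qed (use assms(2) compact_imp_closed in auto)
  thus ?thesis by blast
qed

text \<open>Misiurewicz's argument: averages along orbits of uniform distributions on large separated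
  sets have, in the limit, an invariant distribution of positive entropy. Only finite additivity
  of the limit is needed, so no representation theorem enters.\<close>
theorem exists_proper_asymptotic_pair:
  fixes X :: "'a::metric_space set"
  assumes X: "compact X" and T_in: "T ` X \<subseteq> X" and T_cont: "continuous_on X T"
    and pos: "topological_entropy X T > 0"
  shows "proper_asymptotic_pairs X T \<noteq> {}"
proof -
  obtain c d :: real where c: "c > 0" and d: "d > 0"
    and sep: "\<forall>k::nat. \<exists>n>k. \<exists>E\<subseteq>X. finite E \<and> E \<noteq> {} \<and> ln (card E) \<ge> c * n \<and>
    (\<forall>x\<in>E. \<forall>y\<in>E. x \<noteq> y \<longrightarrow> (\<exists>i<n. dist ((T ^^ i) x) ((T ^^ i) y) \<ge> d))"
    using exists_separated_sets[OF X T_in pos] by (elim exE conjE)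
  have "\<forall>k::nat. \<exists>z :: nat \<times> 'a set. k < fst z \<and> snd z \<subseteq> X \<and> finite (snd z) \<and> snd z \<noteq> {} \<and> ln (card (snd z)) \<ge> c * fst z \<and>
    (\<forall>x\<in>snd z. \<forall>y\<in>snd z. x \<noteq> y \<longrightarrow> (\<exists>i<fst z. dist ((T ^^ i) x) ((T ^^ i) y) \<ge> d))"
  proof
    fix k :: nat
    obtain n E where "k < n" "E \<subseteq> X" "finite E" "E \<noteq> {}" "ln (card E) \<ge> c * n"
      "\<forall>x\<in>E. \<forall>y\<in>E. x \<noteq> y \<longrightarrow> (\<exists>i<n. dist ((T ^^ i) x) ((T ^^ i) y) \<ge> d)"
      using spec[OF sep, of k] by (elim exE conjE)
    thus "\<exists>z :: nat \<times> 'a set. k < fst z \<and> snd z \<subseteq> X \<and> finite (snd z) \<and> snd z \<noteq> {} \<and> ln (card (snd z)) \<ge> c * fst z \<and>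
      (\<forall>x\<in>snd z. \<forall>y\<in>snd z. x \<noteq> y \<longrightarrow> (\<exists>i<fst z. dist ((T ^^ i) x) ((T ^^ i) y) \<ge> d))"
      by (intro exI[of _ "(n, E)"], unfold fst_conv snd_conv, intro conjI)
  qed
  then obtain z :: "nat \<Rightarrow> nat \<times> 'a set" where z: "\<forall>k::nat. k < fst (z k) \<and> snd (z k) \<subseteq> X \<and> finite (snd (z k)) \<and> snd (z k) \<noteq> {} \<and>
      ln (card (snd (z k))) \<ge> c * fst (z k) \<and>
      (\<forall>x\<in>snd (z k). \<forall>y\<in>snd (z k). x \<noteq> y \<longrightarrow> (\<exists>i<fst (z k). dist ((T ^^ i) x) ((T ^^ i) y) \<ge> d))"
    by (rule choice[THEN exE])
  define r where "r k = fst (z k)" for k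
  define E where "E k = snd (z k)" for k
  have r: "k < r k" and EX: "E k \<subseteq> X" and Efin: "finite (E k)" and Ene: "E k \<noteq> {}"
    and Ecard: "ln (card (E k)) \<ge> c * r k"
    and Esep: "\<forall>x\<in>E k. \<forall>y\<in>E k. x \<noteq> y \<longrightarrow> (\<exists>i<r k. dist ((T ^^ i) x) ((T ^^ i) y) \<ge> d)" for k
    using spec[OF z, of k] unfolding r_def E_def by simp_all
  have rpos: "r k > 0" for k using r[of k] by simp
  define \<sigma> where "\<sigma> k A = card (E k \<inter> A) / card (E k)" for k A
  have fa_\<sigma>: "fa_prob X (Pow X) (\<sigma> k)" for k
    unfolding \<sigma>_def[abs_def] using Efin Ene EX by (rule fa_prob_uniform)
  define \<mu> where "\<mu> k A = (\<Sum>i<r k. \<sigma> k ((T ^^ i) -` A \<inter> X)) / r k" for k A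
  have \<sigma>01: "0 \<le> \<sigma> k A" "\<sigma> k A \<le> 1" for k A
    using Efin[of k] card_mono[of "E k" "E k \<inter> A"] by (auto simp: \<sigma>_def divide_le_eq)
  have \<mu>01: "\<mu> k A \<in> {0..1}" for k A
  proof -
    have "(\<Sum>i<r k. \<sigma> k ((T ^^ i) -` A \<inter> X)) \<le> (\<Sum>i<r k. 1)" using \<sigma>01 by (intro sum_mono)
    thus ?thesis using rpos[of k] \<sigma>01 by (auto simp: \<mu>_def divide_le_eq intro!: divide_nonneg_nonneg sum_nonneg)
  qed
  obtain G m where Gb: "G \<noteq> bot" and Gs: "G \<le> sequentially" and lim: "\<And>A. ((\<lambda>k. \<mu> k A) \<longlongrightarrow> m A) G"
    using set_function_limit[of \<mu>, OF \<mu>01] by blast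
  have inv_r: "((\<lambda>k. C / r k) \<longlongrightarrow> 0) G" for C :: real
  proof (rule tendsto_mono[OF Gs])
    have "filterlim (\<lambda>k. real (r k)) at_top sequentially"
      by (rule filterlim_at_top_mono[OF filterlim_real_sequentially]) (use r in \<open>auto intro!: always_eventually less_imp_le\<close>)
    thus "(\<lambda>k. C / r k) \<longlonglongrightarrow> 0" by (rule real_tendsto_divide_at_top[OF tendsto_const])
  qed
  have T_pow_X: "(T ^^ i) -` X \<inter> X = X" for i using funpow_image_subset[OF T_in] by auto
  interpret algebra X "Pow X" by (rule algebra_Pow)
  interpret fa_compact X "Pow X" m
  proof unfold_locales
    fix A
    show "m A \<ge> 0" using \<mu>01 by (intro tendsto_lowerbound[OF lim _ Gb]) auto
  next
    have "\<mu> k X = 1" for k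
      using rpos[of k] fa_prob.m_space[OF fa_\<sigma>[of k]] by (simp add: \<mu>_def T_pow_X)
    thus "m X = 1" using tendsto_unique[OF Gb lim[of X]] by simp
  next
    fix A B assume AB: "A \<in> Pow X" "B \<in> Pow X" "A \<inter> B = {}"
    have "\<mu> k (A \<union> B) = \<mu> k A + \<mu> k B" for k
    proof -
      have "\<sigma> k ((T ^^ i) -` (A \<union> B) \<inter> X) = \<sigma> k ((T ^^ i) -` A \<inter> X) + \<sigma> k ((T ^^ i) -` B \<inter> X)" for i
      proof -
        have "(T ^^ i) -` (A \<union> B) \<inter> X = ((T ^^ i) -` A \<inter> X) \<union> ((T ^^ i) -` B \<inter> X)" by auto
        thus ?thesis using AB(3) by (simp only:) (intro fa_prob.m_add[OF fa_\<sigma>], auto)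
      qed
      thus ?thesis by (simp add: \<mu>_def sum.distrib add_divide_distrib)
    qed
    hence "((\<lambda>k. \<mu> k (A \<union> B)) \<longlongrightarrow> m A + m B) G" using tendsto_add[OF lim lim] by simp
    thus "m (A \<union> B) = m A + m B" using tendsto_unique[OF Gb lim] by blast
  qed (use X in auto)
  \<comment> \<open>The two averages differ by one term at either end, hence by at most
    \<open>1 / r k\<close>, which vanishes along \<open>G\<close>.\<close>
  have inv: "m (T -` A \<inter> X) = m A" if "A \<subseteq> X" for A
  proof -
    have "\<bar>\<mu> k (T -` A \<inter> X) - \<mu> k A\<bar> \<le> 1 / r k" for k
    proof -
      let ?s = "\<lambda>i. \<sigma> k ((T ^^ i) -` A \<inter> X)"
      have "(T ^^ i) -` (T -` A \<inter> X) \<inter> X = (T ^^ Suc i) -` A \<inter> X" for i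
        using funpow_image_subset[OF T_in] by auto
      hence "\<mu> k (T -` A \<inter> X) - \<mu> k A = (\<Sum>i<r k. ?s (Suc i) - ?s i) / r k"
        unfolding \<mu>_def by (simp only: sum_subtractf diff_divide_distrib)
      also have "\<dots> = (?s (r k) - ?s 0) / r k" by (subst sum_lessThan_telescope) simp
      finally have "\<bar>\<mu> k (T -` A \<inter> X) - \<mu> k A\<bar> = \<bar>?s (r k) - ?s 0\<bar> / r k" by simp
      moreover have "\<bar>?s (r k) - ?s 0\<bar> \<le> 1"
        using \<sigma>01[of k "(T ^^ r k) -` A \<inter> X"] \<sigma>01[of k "(T ^^ 0) -` A \<inter> X"] by linarith
      ultimately show ?thesis by (simp add: divide_right_mono)
    qed
    hence "((\<lambda>k. \<mu> k (T -` A \<inter> X) - \<mu> k A) \<longlongrightarrow> 0) G"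
      by (intro Lim_null_comparison[OF _ inv_r[of 1]]) simp
    hence "((\<lambda>k. \<mu> k (T -` A \<inter> X) - \<mu> k A + \<mu> k A) \<longlongrightarrow> 0 + m A) G"
      using lim by (rule tendsto_add)
    thus ?thesis using tendsto_unique[OF Gb lim] by simp
  qed
  \<comment> \<open>The cells are finer than the separation constant, so points of
    \<open>E k\<close> that separate at some time below \<open>r k\<close> get different
    names.\<close>
  obtain a :: "'a \<Rightarrow> nat" where a: "simple a" "nearly_continuous a"
    "\<And>x y. x \<in> X \<Longrightarrow> y \<in> X \<Longrightarrow> a x = a y \<Longrightarrow> dist x y < d"
    using exists_small_nearly_continuous[OF d] by blast
  have "\<forall>k. \<exists>f :: 'a \<Rightarrow> nat. simple f \<and> nearly_continuous f \<and>
      (\<forall>x\<in>X. \<forall>y\<in>X. f x = f y \<longrightarrow> dist x y < 1 / real (Suc k))"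
    by (intro allI exists_small_nearly_continuous) simp
  then obtain b :: "nat \<Rightarrow> 'a \<Rightarrow> nat" where b: "\<And>k. simple (b k)" "\<And>k. nearly_continuous (b k)"
    "\<And>k x y. x \<in> X \<Longrightarrow> y \<in> X \<Longrightarrow> b k x = b k y \<Longrightarrow> dist x y < 1 / real (Suc k)" by metis
  define \<alpha> where "\<alpha> = case_nat a b"
  have \<alpha>_simple: "simple (\<alpha> k)" for k using a(1) b(1) by (cases k) (auto simp: \<alpha>_def)
  interpret fa_compact_system X "Pow X" m T \<alpha>
    by unfold_locales (use T_in T_cont inv \<alpha>_simple in auto)

  let ?N = "\<lambda>q. name T \<alpha> (block {(0, 0)} 0 q)"
  have N_fin: "finite (?N q ` X)" for q by (intro simple_finite simple_name) simp
  have approx: "q * c - q * card (?N q ` X) / r k \<le> fa_entropy X (\<mu> k) (?N q)" for q k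
  proof -
    interpret S: fa_coded_map X "Pow X" "\<sigma> k" T \<alpha>
    proof (intro fa_coded_map.intro fa_\<sigma> fa_coded_map_axioms.intro T_in)
      show "fa_prob.simple X (Pow X) (\<alpha> j)" for j
        using simple_finite[OF \<alpha>_simple] by (auto simp: fa_prob.simple_def[OF fa_\<sigma>])
    qed auto
    have inj: "inj_on (?N (r k)) (E k)"
    proof (rule inj_onI, rule ccontr)
      fix x y assume xy: "x \<in> E k" "y \<in> E k" "?N (r k) x = ?N (r k) y" "x \<noteq> y"
      obtain i where i: "i < r k" "dist ((T ^^ i) x) ((T ^^ i) y) \<ge> d" using Esep xy by blast
      have "(0, 0 + i) \<in> block {(0, 0)} 0 (r k)" using i(1) by (intro mem_block_singleton) auto
      hence "\<alpha> 0 ((T ^^ i) x) = \<alpha> 0 ((T ^^ i) y)" using xy(3) unfolding name_eq_iff by simp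
      hence "a ((T ^^ i) x) = a ((T ^^ i) y)" by (simp add: \<alpha>_def)
      moreover have "(T ^^ i) x \<in> X" "(T ^^ i) y \<in> X" using xy EX T_pow_in by blast+
      ultimately show False using a(3) i(2) by fastforce
    qed
    have "fa_entropy X (\<sigma> k) (?N (r k)) = ln (card (E k))"
      unfolding \<sigma>_def[abs_def] using Efin Ene EX inj N_fin by (rule fa_entropy_uniform_inj)
    hence "q * (c * r k) \<le> q * fa_entropy X (\<sigma> k) (?N (r k))"
      using Ecard[of k] by (simp add: mult_left_mono)
    also have "\<dots> \<le> r k * fa_entropy X (\<mu> k) (?N q) + q * card (?N q ` X)"
      using S.average_entropy_ge[OF rpos, of q] unfolding \<mu>_def[abs_def] .
    finally show ?thesis using rpos[of k] by (simp add: field_simps)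
  qed
  \<comment> \<open>For fixed \<open>q\<close> the error in \<open>approx\<close> vanishes as
    \<open>r k\<close> grows, and the entropy of the finite partition into \<open>q\<close>-names
    passes to the limit by continuity of \<open>eta\<close>.\<close>
  have ge: "q * c \<le> ent (?N q)" for q
  proof -
    have "((\<lambda>k. fa_entropy X (\<mu> k) (?N q)) \<longlongrightarrow> ent (?N q)) G"
      unfolding fa_entropy_def
    proof (intro tendsto_sum tendsto_eta lim)
      fix v
      show "eventually (\<lambda>k. 0 \<le> \<mu> k {x \<in> X. ?N q x = v} \<and> \<mu> k {x \<in> X. ?N q x = v} \<le> 1) G"
        using \<mu>01 by auto
      show "0 \<le> m {x \<in> X. ?N q x = v}" by (rule m_nonneg) auto
    qed
    moreover have "((\<lambda>k. q * c - (q * card (?N q ` X)) / r k) \<longlongrightarrow> q * c - 0) G"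
      by (intro tendsto_diff tendsto_const inv_r)
    ultimately have "q * c - 0 \<le> ent (?N q)"
      by (rule tendsto_le[OF Gb]) (use approx in simp)
    thus ?thesis by simp
  qed
  have "c \<le> rate {(0, 0)}"
  proof (rule LIMSEQ_le_const[OF H_block_tendsto], simp, intro exI allI impI)
    fix q :: nat assume "1 \<le> q"
    thus "c \<le> ent (?N q) / q" using ge[of q] by (simp add: field_simps)
  qed
  hence "rate {(0, 0)} > 0" using c by simp
  moreover have "nearly_continuous (\<alpha> k)" for k using a(2) b(2) by (cases k) (auto simp: \<alpha>_def)
  moreover have "dist x y < 1 / Suc k" if "x \<in> X" "y \<in> X" "\<alpha> (Suc k) x = \<alpha> (Suc k) y" for x y k
    using b(3) that by (simp add: \<alpha>_def)
  ultimately have "\<exists>Q e. e > 0 \<and> decseq Q \<and> (\<forall>N. compact (Q N) \<and> Q N \<subseteq> X \<and> m (Q N) \<ge> e) \<and>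
      (\<Inter>N. Q N) \<subseteq> {x. \<exists>y. (x, y) \<in> proper_asymptotic_pairs X T}"
    by (rule exists_asymptotic_core)
  then obtain Q e where e: "e > 0" and Q: "decseq Q" "\<And>N. compact (Q N)" "\<And>N. m (Q N) \<ge> e"
    and QE: "(\<Inter>N. Q N) \<subseteq> {x. \<exists>y. (x, y) \<in> proper_asymptotic_pairs X T}" by blast
  \<comment> \<open>Finite additivity says nothing about the mass of the intersection. Positive mass
    makes each \<open>Q N\<close> nonempty, and compactness does the rest.\<close>
  have "Q N \<noteq> {}" for N using Q(3)[of N] e by auto
  hence "(\<Inter>N. Q N) \<noteq> {}" using Q by (intro decseq_compact_nonempty)
  thus ?thesis using QE by blast
qed

theorem proposition1:
  fixes X :: "'a::metric_space set" and T :: "'a \<Rightarrow> 'a"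
  assumes "invertible_tds X T"
    and "topological_entropy X T > 0"
  shows "proper_asymptotic_pairs X T \<noteq> {} \<and>
    (\<forall>\<mu>. ergodic_measure X T \<mu> \<and> measure_entropy \<mu> T > 0 \<longrightarrow>
      {x. \<exists>y. (x, y) \<in> proper_asymptotic_pairs X T} \<in> sets (completion \<mu>) \<and>
      emeasure (completion \<mu>) {x. \<exists>y. (x, y) \<in> proper_asymptotic_pairs X T} = 1)"
proof -
  obtain S where X: "compact X" and T: "homeomorphism X X T S"
    using assms(1) unfolding invertible_tds_def by blast
  have "T ` X \<subseteq> X" "continuous_on X T" using T by (auto simp: homeomorphism_def)
  hence "proper_asymptotic_pairs X T \<noteq> {}"
    using exists_proper_asymptotic_pair[OF X _ _ assms(2)] by blast
  thus ?thesis using measure_asymptotic_points_eq_1[OF X T] by blast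
qed

end
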